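(* For every positive integer $k$ there exists a planar graph $G$ of odd-girth $2k+1$ such that $\omega\big(G^{(2k-1)}\big)\geq 2^{2k}$.
   Context: All graphs are finite. The odd-girth of a graph is the length of a shortest odd cycle in it. For a graph $G$ and a positive integer $m$, the $m$-th walk-power $G^{(m)}$ is the graph with vertex set $V(G)$ in which two distinct vertices $x,y$ are adjacent if and only if there is a walk of length exactly $m$ in $G$ connecting $x$ and $y$. $\omega(H)$ denotes the clique number of a graph $H$. *)

theory Defs
  imports "HOL-Analysis.Analysis"
begin

definition simple_graph :: "'a set \<Rightarrow> 'a set set \<Rightarrow> bool" where
  "simple_graph V E \<longleftrightarrow> finite V \<and>
     (\<forall>e\<in>E. \<exists>x y. x \<in> V \<and> y \<in> V \<and> x \<noteq> y \<and> e = {x, y})"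

definition walk_of_length :: "'a set \<Rightarrow> 'a set set \<Rightarrow> nat \<Rightarrow> 'a \<Rightarrow> 'a \<Rightarrow> bool" where
  "walk_of_length V E m x y \<longleftrightarrow>
     (\<exists>w :: 'a list. length w = m + 1 \<and> set w \<subseteq> V \<and> hd w = x \<and> last w = y \<and>
        (\<forall>i<m. {w ! i, w ! Suc i} \<in> E))"

definition has_cycle_of_length :: "'a set \<Rightarrow> 'a set set \<Rightarrow> nat \<Rightarrow> bool" where
  "has_cycle_of_length V E l \<longleftrightarrow> 3 \<le> l \<and>
     (\<exists>c :: 'a list. length c = l \<and> distinct c \<and> set c \<subseteq> V \<and>
        (\<forall>i<l. {c ! i, c ! ((i + 1) mod l)} \<in> E))"

text \<open>Odd girth: length of a shortest odd cycle (infinity if there is none).\<close>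

definition odd_girth :: "'a set \<Rightarrow> 'a set set \<Rightarrow> enat" where
  "odd_girth V E = (INF l \<in> {l. odd l \<and> has_cycle_of_length V E l}. enat l)"

definition walk_power_edges :: "'a set \<Rightarrow> 'a set set \<Rightarrow> nat \<Rightarrow> 'a set set" where
  "walk_power_edges V E m =
     {{x, y} | x y. x \<in> V \<and> y \<in> V \<and> x \<noteq> y \<and> walk_of_length V E m x y}"

definition is_clique :: "'a set \<Rightarrow> 'a set set \<Rightarrow> 'a set \<Rightarrow> bool" where
  "is_clique V E K \<longleftrightarrow> K \<subseteq> V \<and> (\<forall>x\<in>K. \<forall>y\<in>K. x \<noteq> y \<longrightarrow> {x, y} \<in> E)"

definition clique_number :: "'a set \<Rightarrow> 'a set set \<Rightarrow> nat" where
  "clique_number V E = Max {card K | K. is_clique V E K}"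

definition planar :: "'a set \<Rightarrow> 'a set set \<Rightarrow> bool" where
  "planar V E \<longleftrightarrow>
     (\<exists>(p :: 'a \<Rightarrow> complex) (\<gamma> :: 'a set \<Rightarrow> real \<Rightarrow> complex).
        inj_on p V \<and>
        (\<forall>e\<in>E. arc (\<gamma> e) \<and> {pathstart (\<gamma> e), pathfinish (\<gamma> e)} = p ` e \<and>
                 path_image (\<gamma> e) \<inter> p ` V = p ` e) \<and>
        (\<forall>e\<in>E. \<forall>e'\<in>E. e \<noteq> e' \<longrightarrow>
                 path_image (\<gamma> e) \<inter> path_image (\<gamma> e') \<subseteq> p ` (e \<inter> e')))"

end

theory Submission
  imports Defs
begin

text \<open>The graph is built from \<open>K\<^sub>4\<close> by recursion on \<open>k\<close>; put \<open>n = 2k\<close>. Every vertex carries a label, a subset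
  of \<open>{..<n}\<close>. Edges are of two kinds: an ordinary edge flips one element of the label, and a
  \<open>cell\<close> edge complements the label. Since \<open>n\<close> is even, an odd closed walk uses an odd number of cell
  edges, so its other edges have to flip every element, and its length is at least \<open>n + 1\<close>.

  The cell edges \<open>xy\<close> form a perfect matching of a set \<open>K\<close> of vertices on which all \<open>2\<^sup>n\<close> labels occur.
  Write \<open>d\<close> for the distance along ordinary edges. The invariant is that \<open>d(x, y) = n\<close> for every cell
  \<open>xy\<close>, and \<open>d(x, w) + d(y, v) \<le> 2n - 2\<close> and \<open>d(x, v) + d(y, w) \<le> 2n - 2\<close> for distinct cells \<open>xy\<close>
  and \<open>wv\<close>. By parity it gives odd walks of length at most \<open>n - 1\<close> between any two vertices of \<open>K\<close>:
  an odd walk either follows one of these paths directly or enters or leaves it through cell edges.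

  In the step from \<open>n\<close> to \<open>n + 2\<close> each cell edge is replaced by a planar gadget with two new label
  elements \<open>b\<close>, \<open>c\<close>. It contains the vertices obtained from \<open>x\<close> and \<open>y\<close> by flipping \<open>b\<close>, \<open>c\<close> or both, which
  are matched into four new cells. Planarity is kept by drawing all edges straight and
  reserving for each cell a triangle on its edge in which its gadget is drawn by an affine map.\<close>

section \<open>Drawing pieces and refining cells\<close>

text \<open>A vertex is a position together with a label. A piece \<open>(u, v, t)\<close> is either a cell with edge \<open>uv\<close>
  and third triangle corner \<open>t\<close>, or, with \<open>t\<close> degenerated to the position of \<open>u\<close>, a link: a segment that
  stands for a path with one edge per element in which the labels of \<open>u\<close> and \<open>v\<close> differ.\<close>

type_synonym vertex = "complex \<times> nat set"
type_synonym piece = "vertex \<times> vertex \<times> complex"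

fun region :: "piece \<Rightarrow> complex set" where
  "region (u, v, t) = convex hull {fst u, fst v, t}"

fun ends :: "piece \<Rightarrow> vertex set" where
  "ends (u, v, t) = {u, v}"

text \<open>The affine map sending \<open>0\<close>, \<open>20\<close>, \<open>20\<i>\<close> to the corners of the triangle of a cell; the scale makes
  the gadget coordinates integers.\<close>

fun place :: "piece \<Rightarrow> complex \<Rightarrow> complex" where
  "place (u, v, t) z = fst u + (Re z / 20) *\<^sub>R (fst v - fst u) + (Im z / 20) *\<^sub>R (t - fst u)"

text \<open>Labels are translated, under symmetric difference, by the label of the first end.
  Differences of labels therefore survive the transfer, whatever cell the gadget is put
  into.\<close>

definition lift :: "piece \<Rightarrow> vertex \<Rightarrow> vertex" where
  "lift c u = (place c (fst u), sym_diff (snd (fst c)) (snd u))"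

fun lift_piece :: "piece \<Rightarrow> piece \<Rightarrow> piece" where
  "lift_piece c (u, v, t) = (lift c u, lift c v, place c t)"

definition link :: "vertex \<Rightarrow> vertex \<Rightarrow> piece" where
  "link u v = (u, v, fst u)"

definition meet_at_ends :: "piece \<Rightarrow> piece \<Rightarrow> bool" where
  "meet_at_ends a b \<longleftrightarrow> region a \<inter> region b \<subseteq> fst ` (ends a \<inter> ends b)"

definition drawn :: "piece set \<Rightarrow> bool" where
  "drawn P \<longleftrightarrow> (\<forall>a\<in>P. fst (fst a) \<noteq> fst (fst (snd a))) \<and>
     (\<forall>a\<in>P. \<forall>b\<in>P. a \<noteq> b \<longrightarrow> meet_at_ends a b)"

section \<open>Affine images of regions and refinement of a drawing\<close>

lemma region_iff:
  "z \<in> region (u, v, t) \<longleftrightarrow> (\<exists>a b c. 0 \<le> a \<and> 0 \<le> b \<and> 0 \<le> c \<and> a + b + c = 1 \<and>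
     Re z = a * Re (fst u) + b * Re (fst v) + c * Re t \<and>
     Im z = a * Im (fst u) + b * Im (fst v) + c * Im t)"
  by (auto simp: convex_hull_3 complex_eq_iff)

lemma place_affine:
  assumes "a + b + d = 1"
  shows "place c (a *\<^sub>R p + b *\<^sub>R q + d *\<^sub>R s) = a *\<^sub>R place c p + b *\<^sub>R place c q + d *\<^sub>R place c s"
proof -
  obtain u v t where c: "c = (u, v, t)" by (cases c)
  have d: "d = 1 - a - b" using assms by simp
  show ?thesis unfolding c d
    by (simp add: complex_eq_iff) (simp add: field_simps)
qed

lemma region_lift: "region (lift_piece c a) = place c ` region a"
proof -
  obtain u v t where a: "a = (u, v, t)" by (cases a)
  have "region (lift_piece c a) =
      {x *\<^sub>R place c (fst u) + y *\<^sub>R place c (fst v) + z *\<^sub>R place c t | x y z.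
        0 \<le> x \<and> 0 \<le> y \<and> 0 \<le> z \<and> x + y + z = 1}"
    unfolding a lift_piece.simps region.simps lift_def fst_conv convex_hull_3 ..
  also have "\<dots> = {place c (x *\<^sub>R fst u + y *\<^sub>R fst v + z *\<^sub>R t) | x y z.
        0 \<le> x \<and> 0 \<le> y \<and> 0 \<le> z \<and> x + y + z = 1}"
    by (intro Collect_cong ex_cong1) (auto simp: place_affine simp del: place.simps)
  also have "\<dots> = place c ` {x *\<^sub>R fst u + y *\<^sub>R fst v + z *\<^sub>R t | x y z.
        0 \<le> x \<and> 0 \<le> y \<and> 0 \<le> z \<and> x + y + z = 1}"
    by blast
  also have "\<dots> = place c ` region a"
    unfolding a region.simps convex_hull_3 ..
  finally show ?thesis .
qed

text \<open>Placement maps of nested cells compose, so their injectivity passes down the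
  recursion.\<close>

lemma place_lift_piece: "place (lift_piece c a) z = place c (place a z)"
proof -
  obtain u v t where a: "a = (u, v, t)" by (cases a)
  have "place a z = (1 - Re z / 20 - Im z / 20) *\<^sub>R fst u + (Re z / 20) *\<^sub>R fst v + (Im z / 20) *\<^sub>R t"
    unfolding a place.simps scaleR_diff_right scaleR_diff_left by simp
  then have "place c (place a z) = (1 - Re z / 20 - Im z / 20) *\<^sub>R place c (fst u)
      + (Re z / 20) *\<^sub>R place c (fst v) + (Im z / 20) *\<^sub>R place c t"
    using place_affine[of "1 - Re z / 20 - Im z / 20" "Re z / 20" "Im z / 20" c "fst u" "fst v" t]
    by simp
  also have "\<dots> = place (lift_piece c a) z"
    unfolding a lift_piece.simps place.simps lift_def fst_conv scaleR_diff_right scaleR_diff_left by simp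
  finally show ?thesis ..
qed

lemma inj_place_lift_piece: "inj (place c) \<Longrightarrow> inj (place a) \<Longrightarrow> inj (place (lift_piece c a))"
  unfolding inj_def place_lift_piece by blast

text \<open>This tells links from cells: cells are required to have an injective
  \<open>place\<close>, so no piece is both.\<close>

lemma not_inj_place_link: "\<not> inj (place (link u v))"
proof
  assume inj: "inj (place (link u v))"
  have "place (link u v) 0 = place (link u v) \<i>"
    by (simp add: link_def)
  from injD[OF inj this] show False
    by simp
qed

lemma link_lift: "lift_piece c (link u v) = link (lift c u) (lift c v)"
  by (simp add: link_def lift_def)

lemma sym_diff_lift: "sym_diff (snd (lift c u)) (snd (lift c v)) = sym_diff (snd u) (snd v)"
  by (auto simp: lift_def)

lemma meet_at_ends_sym: "meet_at_ends a b \<Longrightarrow> meet_at_ends b a"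
  by (simp add: meet_at_ends_def Int_commute)

text \<open>Here \<open>x\<close> and \<open>y\<close> are the corners that carry vertices. The
  third corner \<open>Complex 0 20\<close> carries none, so contacts with pieces outside the
  triangle have to be controlled only at \<open>x\<close> and \<open>y\<close>.\<close>

definition fits :: "vertex \<Rightarrow> vertex \<Rightarrow> piece \<Rightarrow> bool" where
  "fits x y a \<longleftrightarrow> region a \<subseteq> region (x, y, Complex 0 20) \<and>
     (fst x \<in> region a \<longrightarrow> x \<in> ends a) \<and> (fst y \<in> region a \<longrightarrow> y \<in> ends a)"

text \<open>An end of the cell is \<open>lift c x\<close> or \<open>lift c y\<close>. Injectivity of
  \<open>place c\<close> pulls the contact back to gadget coordinates, where \<open>fits\<close>
  decides it.\<close>

lemma lift_piece_meets:
  assumes c: "c = (lift c x, lift c y, t)" and inj: "inj (place c)"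
    and xy: "fst x = 0" "fst y = 20"
    and a: "fits x y a" and w: "w \<in> ends c" "fst w \<in> region (lift_piece c a)"
  shows "w \<in> ends (lift_piece c a)"
proof -
  have ends: "ends (lift_piece c a) = lift c ` ends a"
    by (cases a) auto
  obtain q where q: "w = lift c q" "q = x \<or> q = y"
    using w(1) c by (metis ends.simps insertE singletonD)
  have "place c (fst q) \<in> place c ` region a"
    using w(2) q(1) by (simp add: lift_def region_lift)
  then have "fst q \<in> region a"
    using inj by (simp add: inj_image_mem_iff)
  then have "q \<in> ends a"
    using a q(2) by (auto simp: fits_def)
  then show ?thesis by (simp add: ends q(1))
qed

lemma region_lift_subset:
  assumes c: "c = (lift c x, lift c y, t)" and xy: "fst x = 0" "fst y = 20" and a: "fits x y a"
  shows "region (lift_piece c a) \<subseteq> region c"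
proof -
  have "place c (Complex 0 20) = t"
    by (subst c, subst (2) c) (simp add: lift_def)
  then have "lift_piece c (x, y, Complex 0 20) = c"
    using c by simp
  then show ?thesis
    using a unfolding region_lift fits_def by (metis image_mono region_lift)
qed

text \<open>Refined pieces stay in the triangle of their cell. A contact with anything outside that
  cell therefore happens at an end of the old cell, and \<open>fits\<close> makes this vertex an end
  of the refined piece too. Inside one cell the injective affine map carries the drawing of
  \<open>G\<close> over.\<close>

lemma drawn_refine:
  assumes drawn: "drawn (L \<union> C)" and disj: "L \<inter> C = {}"
    and cells: "\<And>c. c \<in> C \<Longrightarrow> inj (place c) \<and> (\<exists>t. c = (lift c x, lift c y, t))"
    and xy: "fst x = 0" "fst y = 20"
    and G: "drawn G" "\<And>a. a \<in> G \<Longrightarrow> fits x y a"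
  shows "drawn (L \<union> (\<Union>c\<in>C. lift_piece c ` G))"
proof -
  have meet: "meet_at_ends a b" if "a \<in> L \<union> C" "b \<in> L \<union> C" "a \<noteq> b" for a b
    using drawn that by (auto simp: drawn_def)
  have sub: "region (lift_piece c a) \<subseteq> region c" if ca: "c \<in> C" "a \<in> G" for c a
  proof -
    obtain t where "c = (lift c x, lift c y, t)"
      using cells[OF ca(1)] by blast
    then show ?thesis
      using region_lift_subset xy G(2)[OF that(2)] by blast
  qed
  have corner: "w \<in> ends (lift_piece c a)" 
    if ca: "c \<in> C" "a \<in> G" "w \<in> ends c" "fst w \<in> region (lift_piece c a)" for c a w
  proof -
    obtain t where "c = (lift c x, lift c y, t)"
      using cells[OF ca(1)] by blast
    then show ?thesis
      using lift_piece_meets[OF _ _ xy G(2)[OF that(2)]] cells[OF that(1)] that by blast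
  qed
  have old_new: "meet_at_ends l (lift_piece c a)" if lca: "l \<in> L" "c \<in> C" "a \<in> G" for l c a
    unfolding meet_at_ends_def
  proof
    fix z assume z: "z \<in> region l \<inter> region (lift_piece c a)"
    have "l \<noteq> c" using that disj by auto
    then have "region l \<inter> region c \<subseteq> fst ` (ends l \<inter> ends c)"
      using meet[of l c] that by (auto simp: meet_at_ends_def)
    then obtain w where w: "z = fst w" "w \<in> ends l" "w \<in> ends c"
      using z sub[of c a] lca by blast
    then show "z \<in> fst ` (ends l \<inter> ends (lift_piece c a))"
      using corner[of c a w] that z by auto
  qed
  have new_new: "meet_at_ends (lift_piece c a) (lift_piece d b)"
    if cd: "c \<in> C" "d \<in> C" "a \<in> G" "b \<in> G" "lift_piece c a \<noteq> lift_piece d b" for c d a b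
  proof (cases "c = d")
    case True
    then have "a \<noteq> b" using that by auto
    then have "region a \<inter> region b \<subseteq> fst ` (ends a \<inter> ends b)"
      using G(1) that by (auto simp: drawn_def meet_at_ends_def)
    then have "place c ` (region a \<inter> region b) \<subseteq> place c ` fst ` (ends a \<inter> ends b)"
      by (rule image_mono)
    also have "place c ` fst ` (ends a \<inter> ends b) = fst ` lift c ` (ends a \<inter> ends b)"
      by (simp add: image_image lift_def)
    also have "lift c ` (ends a \<inter> ends b) \<subseteq> ends (lift_piece c a) \<inter> ends (lift_piece c b)"
      by (cases a; cases b) auto
    finally show ?thesis
      using cells[OF that(1)] True
      by (simp add: meet_at_ends_def region_lift image_Int image_mono)
  next
    case False
    show ?thesis unfolding meet_at_ends_def
    proof
      fix z assume z: "z \<in> region (lift_piece c a) \<inter> region (lift_piece d b)"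
      have "region c \<inter> region d \<subseteq> fst ` (ends c \<inter> ends d)"
        using meet[of c d] that False by (auto simp: meet_at_ends_def)
      then obtain w where w: "z = fst w" "w \<in> ends c" "w \<in> ends d"
        using z sub[of c a] sub[of d b] cd by blast
      then show "z \<in> fst ` (ends (lift_piece c a) \<inter> ends (lift_piece d b))"
        using corner[of c a w] corner[of d b w] that z by auto
    qed
  qed
  have distinct: "fst (fst (lift_piece c a)) \<noteq> fst (fst (snd (lift_piece c a)))"
    if "c \<in> C" "a \<in> G" for c a
  proof -
    have "fst (fst a) \<noteq> fst (fst (snd a))"
      using G(1) that by (simp add: drawn_def)
    then show ?thesis
      using cells[OF that(1)] by (cases a) (auto simp: lift_def dest: injD)
  qed
  show ?thesis
    unfolding drawn_def
  proof (intro conjI ballI impI)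
    fix a assume "a \<in> L \<union> (\<Union>c\<in>C. lift_piece c ` G)"
    then show "fst (fst a) \<noteq> fst (fst (snd a))"
      using distinct drawn unfolding drawn_def by blast
  next
    fix a b
    assume "a \<in> L \<union> (\<Union>c\<in>C. lift_piece c ` G)" "b \<in> L \<union> (\<Union>c\<in>C. lift_piece c ` G)" "a \<noteq> b"
    then show "meet_at_ends a b"
      using meet[of a b] old_new meet_at_ends_sym[OF old_new] new_new by fast
  qed
qed

section \<open>The gadget in coordinates\<close>

lemma sorted_wrt_pairwise:
  assumes "sorted_wrt Q xs" "\<And>a b. Q a b \<Longrightarrow> Q b a" "a \<in> set xs" "b \<in> set xs" "a \<noteq> b"
  shows "Q a b"
  using assms by (induction xs) auto

text \<open>The gadget is a drawing of \<open>K\<^sub>4\<close> on \<open>x\<close>, \<open>y\<close>, \<open>x\<^sub>c\<close>, \<open>y\<^sub>c\<close> without the edge \<open>xy\<close>, in which \<open>x y\<^sub>c\<close> and \<open>y x\<^sub>c\<close> are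
  thickened to the quadrilaterals \<open>x x\<^sub>b y\<^sub>c y\<^bsub>bc\<^esub>\<close> and \<open>y y\<^sub>b x\<^sub>c x\<^bsub>bc\<^esub>\<close>, each with one diagonal. The new label
  elements are \<open>b = n\<close> and \<open>c = n + 1\<close>.\<close>

definition "gx = (Complex 0 0, {} :: nat set)"
definition "gy n = (Complex 20 0, {..<n::nat})"
definition "gxb n = (Complex 4 1, {n::nat})"
definition "gxc n = (Complex 2 12, {Suc n})"
definition "gxbc n = (Complex 12 7, {n, Suc n})"
definition "gyb n = (Complex 10 5, insert n {..<n::nat})"
definition "gyc n = (Complex 6 3, insert (Suc n) {..<n})"
definition "gybc n = (Complex 2 2, insert n (insert (Suc n) {..<n}))"

lemmas gadget_vertex_defs = gx_def gy_def gxb_def gxc_def gxbc_def gyb_def gyc_def gybc_def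

text \<open>The first six links are single edges, each flipping one new element. The last three join
  the \<open>x\<close> side to the \<open>y\<close> side by paths of lengths \<open>n\<close>,
  \<open>n + 1\<close> and \<open>n + 1\<close>.\<close>

definition gadget_links :: "nat \<Rightarrow> piece list" where
  "gadget_links n = [link gx (gxb n), link gx (gxc n), link (gxc n) (gxbc n),
     link (gy n) (gyb n), link (gy n) (gyc n), link (gyc n) (gybc n),
     link (gxc n) (gyc n), link (gxb n) (gybc n), link (gxbc n) (gyb n)]"

text \<open>The four pairs are those with complementary labels in \<open>{..<n + 2}\<close>; the old
  edge between \<open>gx\<close> and \<open>gy n\<close> is gone. The third corners are integer
  points for which the triangles stay clear of the other pieces.\<close>

definition gadget_cells :: "nat \<Rightarrow> piece list" where
  "gadget_cells n = [(gx, gybc n, Complex 2 1), (gxb n, gyc n, Complex 4 2),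
     (gxc n, gyb n, Complex 8 8), (gxbc n, gy n, Complex 14 4)]"

lemma gadget_drawn: "drawn (set (gadget_links n @ gadget_cells n))"
proof -
  have sorted: "sorted_wrt meet_at_ends (gadget_links n @ gadget_cells n)"
    unfolding gadget_links_def gadget_cells_def
    apply (simp add: link_def del: region.simps)
    apply (intro conjI)
    \<comment> \<open>Barycentric coordinates turn each of the 78 pairs into a system of linear
      constraints that is either infeasible or forces the point to be a shared end. Sorting by a
      symmetric relation avoids checking both orders.\<close>
    apply (simp_all add: meet_at_ends_def subset_iff Int_insert_left gadget_vertex_defs
        complex_eq_iff region_iff del: region.simps)
    apply safe
    apply linarith+
    done
  have "meet_at_ends a b" if "a \<in> set (gadget_links n @ gadget_cells n)" 
      "b \<in> set (gadget_links n @ gadget_cells n)" "a \<noteq> b" for a b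
    by (rule sorted_wrt_pairwise[OF sorted meet_at_ends_sym that])
  moreover have "\<forall>a\<in>set (gadget_links n @ gadget_cells n). fst (fst a) \<noteq> fst (fst (snd a))"
    by (auto simp: gadget_links_def gadget_cells_def link_def gadget_vertex_defs)
  ultimately show ?thesis
    unfolding drawn_def by blast
qed

lemma gadget_fits: "\<forall>a\<in>set (gadget_links n @ gadget_cells n). fits gx (gy n) a"
proof -
  have sub: "region (u, v, t) \<subseteq> region (gx, gy n, Complex 0 20)"
    if "Re (fst u) \<ge> 0" "Im (fst u) \<ge> 0" "Re (fst u) + Im (fst u) \<le> 20"
       "Re (fst v) \<ge> 0" "Im (fst v) \<ge> 0" "Re (fst v) + Im (fst v) \<le> 20"
       "Re t \<ge> 0" "Im t \<ge> 0" "Re t + Im t \<le> 20" for u v t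
  proof -
    have "z \<in> region (gx, gy n, Complex 0 20)" if "Re z \<ge> 0" "Im z \<ge> 0" "Re z + Im z \<le> 20" for z
      unfolding region_iff
      \<comment> \<open>The witnesses are the barycentric coordinates of \<open>z\<close> for the
        corners \<open>0\<close>, \<open>20\<close> and \<open>Complex 0 20\<close>.\<close>
      by (rule exI[of _ "1 - Re z / 20 - Im z / 20"], rule exI[of _ "Re z / 20"],
          rule exI[of _ "Im z / 20"]) (use that in \<open>simp add: gx_def gy_def\<close>)
    then show ?thesis
      using that unfolding region.simps by (intro hull_minimal) auto
  qed
  have "\<forall>a\<in>set (gadget_links n @ gadget_cells n). region a \<subseteq> region (gx, gy n, Complex 0 20)"
    unfolding gadget_links_def gadget_cells_def link_def
    apply (simp del: region.simps)
    apply (intro conjI sub)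
    apply (simp_all add: gadget_vertex_defs)
    done
  moreover have "\<forall>a\<in>set (gadget_links n @ gadget_cells n).
      (fst gx \<in> region a \<longrightarrow> gx \<in> ends a) \<and> (fst (gy n) \<in> region a \<longrightarrow> gy n \<in> ends a)"
    unfolding gadget_links_def gadget_cells_def link_def
    by (simp add: gadget_vertex_defs region_iff del: region.simps)
  ultimately show ?thesis
    unfolding fits_def by blast
qed

text \<open>The hypothesis says that the two side vectors at \<open>fst u\<close> have nonzero
  determinant; Cramer's rule then makes the coordinate differences \<open>s\<close> and
  \<open>r\<close> vanish.\<close>

lemma inj_place:
  assumes "(Re (fst v) - Re (fst u)) * (Im t - Im (fst u)) \<noteq> (Im (fst v) - Im (fst u)) * (Re t - Re (fst u))"
  shows "inj (place (u, v, t))"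
proof (rule injI)
  fix z w assume eq: "place (u, v, t) z = place (u, v, t) w"
  define A B C D where "A = Re (fst v) - Re (fst u)" "B = Re t - Re (fst u)"
    "C = Im (fst v) - Im (fst u)" "D = Im t - Im (fst u)"
  define s r where "s = Re z - Re w" "r = Im z - Im w"
  have 1: "s * A + r * B = 0" and 2: "s * C + r * D = 0"
    using eq by (simp_all add: complex_eq_iff s_r_def flip: A_B_C_D_def) (simp_all add: field_simps)
  have "s * (A * D - C * B) = (s * A + r * B) * D - (s * C + r * D) * B"
    "r * (A * D - C * B) = (s * C + r * D) * A - (s * A + r * B) * C"
    by (simp_all add: algebra_simps)
  then have "s = 0" "r = 0"
    using 1 2 assms by (auto simp: A_B_C_D_def)
  then show "z = w"
    by (simp add: s_r_def complex_eq_iff)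
qed

lemma gadget_cells_inj: "\<forall>a\<in>set (gadget_cells n). inj (place a)"
  by (simp add: gadget_cells_def inj_place gadget_vertex_defs del: place.simps)

section \<open>Walks and the recursion step\<close>

definition flips :: "vertex \<Rightarrow> vertex \<Rightarrow> nat set" where
  "flips u v = sym_diff (snd u) (snd v)"

text \<open>The subdivision of a link. Flipping the differing elements in increasing order is an
  arbitrary choice that fixes one path; the points are equally spaced on the segment.\<close>

definition waypoint :: "vertex \<Rightarrow> vertex \<Rightarrow> nat \<Rightarrow> vertex" where
  "waypoint u v i = (linepath (fst u) (fst v) (real i / real (card (flips u v))),
     sym_diff (snd u) (set (take i (sorted_list_of_set (flips u v)))))"

fun link_edges :: "piece \<Rightarrow> vertex set set" where
  "link_edges (u, v, t) = {{waypoint u v i, waypoint u v (Suc i)} | i. i < card (flips u v)}"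

text \<open>Cell edges do not enter, so powers of this relation are the walks along ordinary edges
  that the invariant measures.\<close>

definition steps :: "piece set \<Rightarrow> vertex rel" where
  "steps L = {(p, q). \<exists>a\<in>L. {p, q} \<in> link_edges a}"

lemma flips_lift: "flips (lift c u) (lift c v) = flips u v"
  unfolding flips_def by (rule sym_diff_lift)

lemma waypoint_0: "waypoint u v 0 = u"
  by (simp add: waypoint_def linepath_def)

lemma waypoint_card:
  assumes "finite (flips u v)" "flips u v \<noteq> {}"
  shows "waypoint u v (card (flips u v)) = v"
proof -
  have "sym_diff (snd u) (flips u v) = snd v"
    unfolding flips_def by blast
  moreover have "set (take (card (flips u v)) (sorted_list_of_set (flips u v))) = flips u v"
    using assms by simp
  moreover have "real (card (flips u v)) / real (card (flips u v)) = 1"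
    using assms by simp
  ultimately show ?thesis
    unfolding waypoint_def linepath_def by simp
qed

lemma sym_steps: "sym (steps L)"
  unfolding sym_def steps_def by (simp add: insert_commute)

lemma steps_mono: "L \<subseteq> L' \<Longrightarrow> steps L \<subseteq> steps L'"
  unfolding steps_def by blast

lemma link_walk:
  assumes "link u v \<in> L" "finite (flips u v)" "flips u v \<noteq> {}"
  shows "(u, v) \<in> steps L ^^ card (flips u v)"
proof -
  have "(waypoint u v i, waypoint u v (Suc i)) \<in> steps L" if "i < card (flips u v)" for i
  proof -
    have "{waypoint u v i, waypoint u v (Suc i)} \<in> link_edges (link u v)"
      unfolding link_def link_edges.simps using that by blast
    then show ?thesis
      unfolding steps_def using assms(1) by blast
  qed
  then show ?thesis
    unfolding relpow_fun_conv using waypoint_0 waypoint_card[OF assms(2,3)] by blast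
qed

section \<open>Walks and pairs of walks\<close>

lemma relpow_sym:
  assumes "sym R" "(a, b) \<in> R ^^ m"
  shows "(b, a) \<in> R ^^ m"
proof -
  obtain f where f: "f 0 = a" "f m = b" "\<forall>i<m. (f i, f (Suc i)) \<in> R"
    using assms(2) unfolding relpow_fun_conv by blast
  have "(f (m - i), f (m - Suc i)) \<in> R" if "i < m" for i
    using symD[OF assms(1) f(3)[rule_format, of "m - Suc i"]] that by (simp add: Suc_diff_Suc)
  then show ?thesis
    unfolding relpow_fun_conv using f by (intro exI[of _ "\<lambda>i. f (m - i)"]) simp
qed

lemma relpow_mono:
  fixes R S :: "'a rel"
  assumes "R \<subseteq> S"
  shows "R ^^ m \<subseteq> S ^^ m"
  using assms by (induction m) (simp_all add: relcomp_mono)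

text \<open>This is the bound d(a, a') + d(b, b') <= m of the invariant, expressed by walks so that
  no distance function is needed.\<close>

definition joined :: "'a rel \<Rightarrow> nat \<Rightarrow> 'a \<Rightarrow> 'a \<Rightarrow> 'a \<Rightarrow> 'a \<Rightarrow> bool" where
  "joined R m a b a' b' \<longleftrightarrow> (\<exists>p q. (a, a') \<in> R ^^ p \<and> (b, b') \<in> R ^^ q \<and> p + q \<le> m)"

lemma joinedI: "(a, a') \<in> R ^^ p \<Longrightarrow> (b, b') \<in> R ^^ q \<Longrightarrow> p + q \<le> m \<Longrightarrow> joined R m a b a' b'"
  by (auto simp: joined_def)

lemma joined_swap: "joined R m a b a' b' \<Longrightarrow> joined R m b a b' a'"
  unfolding joined_def by (metis add.commute)

lemma joined_sym: "sym R \<Longrightarrow> joined R m a b a' b' \<Longrightarrow> joined R m a' b' a b"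
  unfolding joined_def by (meson relpow_sym)

lemma joined_trans:
  assumes "joined R m a b a' b'" "joined R m' a' b' a'' b''"
  shows "joined R (m + m') a b a'' b''"
proof -
  obtain p q p' q' where "(a, a') \<in> R ^^ p" "(b, b') \<in> R ^^ q" "p + q \<le> m"
     "(a', a'') \<in> R ^^ p'" "(b', b'') \<in> R ^^ q'" "p' + q' \<le> m'"
    using assms unfolding joined_def by blast
  then show ?thesis
    by (intro joinedI[of a a'' "p + p'" R b b'' "q + q'"]) (auto intro: relpow_trans)
qed

lemma joined_mono: "R \<subseteq> S \<Longrightarrow> m \<le> m' \<Longrightarrow> joined R m a b a' b' \<Longrightarrow> joined S m' a b a' b'"
  unfolding joined_def by (meson order_trans relpow_mono subsetD)

text \<open>The suffixes \<open>p\<close>, \<open>q\<close>, \<open>s\<close> stand for flipping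
  \<open>b\<close>, \<open>c\<close> and both. Each new cell is within total distance 2 of the pair
  \<open>x\<close>, \<open>y\<close>, which settles the uncrossed pairings. For a crossed pairing
  one walk follows the old walk from \<open>x\<close> to \<open>y\<close> and the other a long link,
  with total \<open>2 * n + 2\<close>, that is \<open>2 * (n + 2) - 2\<close>.\<close>

lemma gadget_walks:
  assumes sym: "sym R" and xy: "(x, y) \<in> R ^^ n" and n: "2 \<le> n"
    and edges: "(x, xp) \<in> R" "(x, xq) \<in> R" "(xq, xs) \<in> R" "(y, yp) \<in> R" "(y, yq) \<in> R" "(yq, ys) \<in> R"
    and xcyc: "(xq, yq) \<in> R ^^ n" and xbybc: "(xp, ys) \<in> R ^^ Suc n" and xbcyb: "(xs, yp) \<in> R ^^ Suc n"
  defines "Q \<equiv> \<lambda>(u, v) (u', v'). joined R (2 * n + 2) u v u' v' \<and> joined R (2 * n + 2) u v v' u'"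
  shows "sorted_wrt Q [(x, ys), (xp, yq), (xq, yp), (xs, y)]"
    and "\<forall>(u, v)\<in>{(x, ys), (xp, yq), (xq, yp), (xs, y)}. (u, v) \<in> R ^^ (n + 2) \<and> joined R 2 u v x y"
proof -
  have e: "(x, xp) \<in> R ^^ 1" "(x, xq) \<in> R ^^ 1" "(xq, xs) \<in> R ^^ 1" "(y, yp) \<in> R ^^ 1" "(y, yq) \<in> R ^^ 1" "(yq, ys) \<in> R ^^ 1"
    using edges by simp_all
  note e' = e[THEN relpow_sym[OF sym]]
  note T = relpow_trans
  have x_ybc: "(x, ys) \<in> R ^^ (n + 1 + 1)" by (rule T[OF T[OF xy e(5)] e(6)])
  have xb_yc: "(xp, yq) \<in> R ^^ (1 + n + 1)" by (rule T[OF T[OF e'(1) xy] e(5)])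
  have xc_yb: "(xq, yp) \<in> R ^^ (1 + n + 1)" by (rule T[OF T[OF e'(2) xy] e(4)])
  have xbc_y: "(xs, y) \<in> R ^^ (1 + 1 + n)" by (rule T[OF T[OF e'(3) e'(2)] xy])
  have ybc_y: "(ys, y) \<in> R ^^ (1 + 1)" by (rule T[OF e'(6) e'(5)])
  have xbc_x: "(xs, x) \<in> R ^^ (1 + 1)" by (rule T[OF e'(3) e'(2)])
  have zero: "(z, z) \<in> R ^^ 0" for z by simp
  have near: "joined R 2 x ys x y" "joined R 2 xp yq x y" "joined R 2 xq yp x y" "joined R 2 xs y x y"
    using joinedI[OF zero ybc_y, of 2 x] joinedI[OF e'(1) e'(5), of 2] joinedI[OF e'(2) e'(4), of 2]
      joinedI[OF xbc_x zero, of 2 y] by simp_all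
  show "\<forall>(u, v)\<in>{(x, ys), (xp, yq), (xq, yp), (xs, y)}. (u, v) \<in> R ^^ (n + 2) \<and> joined R 2 u v x y"
    using near x_ybc xb_yc xc_yb xbc_y by simp
  have same: "joined R (2 * n + 2) u v u' v'" if "joined R 2 u v x y" "joined R 2 u' v' x y" for u v u' v'
    using joined_mono[OF subset_refl _ joined_trans[OF that(1) joined_sym[OF sym that(2)]], of "2 * n + 2"] n by simp
  have 1: "joined R (2 * n + 2) x ys yq xp"
    by (rule joinedI[OF T[OF xy e(5)] relpow_sym[OF sym xbybc]]) simp
  have 2: "joined R (2 * n + 2) x ys yp xq"
    by (rule joinedI[OF T[OF xy e(4)] T[OF e'(6) relpow_sym[OF sym xcyc]]]) simp
  have 3: "joined R (2 * n + 2) x ys y xs"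
    by (rule joinedI[OF xy T[OF T[OF e'(6) relpow_sym[OF sym xcyc]] e(3)]]) simp
  have 4: "joined R (2 * n + 2) xp yq yp xq"
    by (rule joinedI[OF T[OF T[OF e'(1) xy] e(4)] relpow_sym[OF sym xcyc]]) simp
  have 5: "joined R (2 * n + 2) xp yq y xs"
    by (rule joinedI[OF T[OF e'(1) xy] T[OF relpow_sym[OF sym xcyc] e(3)]]) simp
  have 6: "joined R (2 * n + 2) xq yp y xs"
    by (rule joinedI[OF T[OF e'(2) xy] relpow_sym[OF sym xbcyb]]) simp
  show "sorted_wrt Q [(x, ys), (xp, yq), (xq, yp), (xs, y)]"
    using 1 2 3 4 5 6 near same by (simp add: Q_def)
qed

section \<open>The invariant and its preservation\<close>

abbreviation src :: "piece \<Rightarrow> vertex" where "src \<equiv> fst"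
abbreviation dst :: "piece \<Rightarrow> vertex" where "dst a \<equiv> fst (snd a)"

text \<open>For a cell just a walk of length \<open>n\<close> is recorded; it is shortest because
  the labels of the ends differ in \<open>n\<close> elements and an ordinary edge flips one. The
  bound \<open>2 * n - 2\<close> makes one of two ordinary walks have length at most
  \<open>n - 1\<close>.\<close>

definition stage :: "nat \<Rightarrow> piece set \<Rightarrow> piece set \<Rightarrow> bool" where
  "stage n L C \<longleftrightarrow> finite L \<and> finite C \<and> drawn (L \<union> C) \<and>
     (\<forall>l\<in>L. \<exists>u v. l = link u v \<and> flips u v \<subseteq> {..<n} \<and> flips u v \<noteq> {}) \<and>
     (\<forall>c\<in>C. inj (place c) \<and> snd (dst c) = sym_diff (snd (src c)) {..<n} \<and>
        (src c, dst c) \<in> steps L ^^ n) \<and>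
     snd ` (\<Union>c\<in>C. ends c) = Pow {..<n} \<and>
     (\<forall>c\<in>C. \<forall>d\<in>C. c \<noteq> d \<longrightarrow>
        joined (steps L) (2 * n - 2) (src c) (dst c) (src d) (dst d) \<and>
        joined (steps L) (2 * n - 2) (src c) (dst c) (dst d) (src d))"

lemma gadget_flips:
  "flips gx (gxb n) = {n}" "flips gx (gxc n) = {Suc n}" "flips (gxc n) (gxbc n) = {n}"
  "flips (gy n) (gyb n) = {n}" "flips (gy n) (gyc n) = {Suc n}" "flips (gyc n) (gybc n) = {n}"
  "flips (gxc n) (gyc n) = {..<n}" "flips (gxb n) (gybc n) = insert (Suc n) {..<n}"
  "flips (gxbc n) (gyb n) = insert (Suc n) {..<n}"
  by (auto simp: flips_def gadget_vertex_defs)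

text \<open>Two new cells in one gadget are covered by \<open>gadget_walks\<close>. For different
  old cells, passing between a new cell and its parent costs 2 on each side, so the old bound grows
  by 4, exactly what the new invariant allows.\<close>

lemma stage_step:
  assumes st: "stage n L C" and n: "2 \<le> n"
  defines "L' \<equiv> L \<union> (\<Union>c\<in>C. lift_piece c ` set (gadget_links n))"
    and "C' \<equiv> \<Union>c\<in>C. lift_piece c ` set (gadget_cells n)"
  shows "stage (n + 2) L' C'"
proof -
  let ?R = "steps L'"
  have fin: "finite L" "finite C" and drawn: "drawn (L \<union> C)"
    and links: "\<And>l. l \<in> L \<Longrightarrow> \<exists>u v. l = link u v \<and> flips u v \<subseteq> {..<n} \<and> flips u v \<noteq> {}"
    and inj: "\<And>c. c \<in> C \<Longrightarrow> inj (place c)"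
    and label: "\<And>c. c \<in> C \<Longrightarrow> snd (dst c) = sym_diff (snd (src c)) {..<n}"
    and walk: "\<And>c. c \<in> C \<Longrightarrow> (src c, dst c) \<in> steps L ^^ n"
    and labels: "snd ` (\<Union>c\<in>C. ends c) = Pow {..<n}"
    and join: "\<And>c d. c \<in> C \<Longrightarrow> d \<in> C \<Longrightarrow> c \<noteq> d \<Longrightarrow>
        joined (steps L) (2 * n - 2) (src c) (dst c) (src d) (dst d) \<and>
        joined (steps L) (2 * n - 2) (src c) (dst c) (dst d) (src d)"
    using st unfolding stage_def by simp_all
  have src: "lift c gx = src c" for c
    by (cases c) (simp add: lift_def gx_def Complex_eq_0)
  have dst: "lift c (gy n) = dst c" if "c \<in> C" for c
  proof -
    have "place c (Complex 20 0) = fst (dst c)"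
      by (cases c) (simp add: complex_eq_iff)
    then show ?thesis
      using label[OF that] by (auto simp: lift_def gy_def prod_eq_iff)
  qed
  have disj: "L \<inter> C = {}"
  proof (intro equals0I, elim IntE)
    fix l assume "l \<in> L" "l \<in> C"
    then show False
      using links[of l] inj[of l] not_inj_place_link by blast
  qed
  have mono: "steps L \<subseteq> ?R"
    by (rule steps_mono) (simp add: L'_def)
  have sym: "sym ?R" by (rule sym_steps)

  \<comment> \<open>\<open>Q\<close> serves pairs of new cells inside one gadget; \<open>N\<close>
    gives each new cell its own walk and its closeness to the old cell.\<close>
  have Q: "sorted_wrt (\<lambda>(u, v) (u', v'). joined ?R (2 * n + 2) u v u' v' \<and> joined ?R (2 * n + 2) u v v' u')
        [(src c, lift c (gybc n)), (lift c (gxb n), lift c (gyc n)), (lift c (gxc n), lift c (gyb n)), (lift c (gxbc n), dst c)]"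
    and N: "\<forall>(u, v)\<in>{(src c, lift c (gybc n)), (lift c (gxb n), lift c (gyc n)), (lift c (gxc n), lift c (gyb n)), (lift c (gxbc n), dst c)}.
       (u, v) \<in> ?R ^^ (n + 2) \<and> joined ?R 2 u v (src c) (dst c)" if c: "c \<in> C" for c
  proof -
    have "(lift c u, lift c v) \<in> ?R ^^ card (flips u v)"
      if uv: "link u v \<in> set (gadget_links n)" "finite (flips u v)" "flips u v \<noteq> {}" for u v
    proof -
      have "link (lift c u) (lift c v) \<in> L'"
        using c uv(1) unfolding L'_def link_lift[symmetric] by blast
      from link_walk[OF this] show ?thesis
        using uv by (simp add: flips_lift)
    qed
    note W = this
    have W9: "(lift c gx, lift c (gxb n)) \<in> ?R" "(lift c gx, lift c (gxc n)) \<in> ?R"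
      "(lift c (gxc n), lift c (gxbc n)) \<in> ?R" "(lift c (gy n), lift c (gyb n)) \<in> ?R"
      "(lift c (gy n), lift c (gyc n)) \<in> ?R" "(lift c (gyc n), lift c (gybc n)) \<in> ?R"
      "(lift c (gxc n), lift c (gyc n)) \<in> ?R ^^ n" "(lift c (gxb n), lift c (gybc n)) \<in> ?R ^^ Suc n"
      "(lift c (gxbc n), lift c (gyb n)) \<in> ?R ^^ Suc n"
      using W[of gx "gxb n"] W[of gx "gxc n"] W[of "gxc n" "gxbc n"] W[of "gy n" "gyb n"] W[of "gy n" "gyc n"]
        W[of "gyc n" "gybc n"] W[of "gxc n" "gyc n"] W[of "gxb n" "gybc n"] W[of "gxbc n" "gyb n"] n
      by (simp_all add: gadget_links_def gadget_flips lessThan_empty_iff relpow_1[unfolded One_nat_def] del: relpow.simps)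
    have xy: "(src c, dst c) \<in> ?R ^^ n"
      using walk[OF c] relpow_mono[OF mono] by blast
    note G = gadget_walks[OF sym xy n W9[unfolded src dst[OF c]]]
    show "sorted_wrt (\<lambda>(u, v) (u', v'). joined ?R (2 * n + 2) u v u' v' \<and> joined ?R (2 * n + 2) u v v' u')
        [(src c, lift c (gybc n)), (lift c (gxb n), lift c (gyc n)), (lift c (gxc n), lift c (gyb n)), (lift c (gxbc n), dst c)]"
      by (rule G(1))
    show "\<forall>(u, v)\<in>{(src c, lift c (gybc n)), (lift c (gxb n), lift c (gyc n)), (lift c (gxc n), lift c (gyb n)), (lift c (gxbc n), dst c)}.
       (u, v) \<in> ?R ^^ (n + 2) \<and> joined ?R 2 u v (src c) (dst c)"
      by (rule G(2))
  qed
  have cells_of: "lift_piece c ` set (gadget_cells n) =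
      {(src c, lift c (gybc n), place c (Complex 2 1)), (lift c (gxb n), lift c (gyc n), place c (Complex 4 2)),
       (lift c (gxc n), lift c (gyb n), place c (Complex 8 8)), (lift c (gxbc n), dst c, place c (Complex 14 4))}"
    if "c \<in> C" for c
    using src dst[OF that] by (simp add: gadget_cells_def del: place.simps)

  have "finite L'" "finite C'"
    using fin by (simp_all add: L'_def C'_def)
  moreover have "drawn (L' \<union> C')"
  proof -
    have "L' \<union> C' = L \<union> (\<Union>c\<in>C. lift_piece c ` set (gadget_links n @ gadget_cells n))"
      by (auto simp: L'_def C'_def)
    moreover have "drawn (L \<union> (\<Union>c\<in>C. lift_piece c ` set (gadget_links n @ gadget_cells n)))"
    proof (rule drawn_refine[OF drawn disj _ _ _ gadget_drawn])
      show "inj (place c) \<and> (\<exists>t. c = (lift c gx, lift c (gy n), t))" if "c \<in> C" for c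
        using inj[OF that] unfolding src dst[OF that]
        by (intro conjI exI[of _ "snd (snd c)"]) simp_all
      show "fst gx = 0" "fst (gy n) = 20"
        by (simp_all add: gx_def gy_def complex_eq_iff)
      show "fits gx (gy n) a" if "a \<in> set (gadget_links n @ gadget_cells n)" for a
        using gadget_fits that by blast
    qed
    ultimately show ?thesis by simp
  qed
  moreover have "\<exists>u v. l = link u v \<and> flips u v \<subseteq> {..<n + 2} \<and> flips u v \<noteq> {}" if l: "l \<in> L'" for l
  proof (cases "l \<in> L")
    case True
    then show ?thesis using links[OF True] by fastforce
  next
    case False
    then obtain c g where "c \<in> C" "g \<in> set (gadget_links n)" "l = lift_piece c g"
      using l by (auto simp: L'_def)
    moreover obtain u v where "g = link u v" "flips u v \<subseteq> {..<n + 2} \<and> flips u v \<noteq> {}"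
    proof -
      define S where "S = {(gx, gxb n), (gx, gxc n), (gxc n, gxbc n), (gy n, gyb n), (gy n, gyc n), (gyc n, gybc n),
          (gxc n, gyc n), (gxb n, gybc n), (gxbc n, gyb n)}"
      have "g \<in> (\<lambda>p. link (fst p) (snd p)) ` S"
        using \<open>g \<in> set (gadget_links n)\<close> by (simp add: gadget_links_def S_def)
      then obtain p where "p \<in> S" "g = link (fst p) (snd p)"
        by blast
      moreover have "\<forall>p\<in>S. flips (fst p) (snd p) \<subseteq> {..<n + 2} \<and> flips (fst p) (snd p) \<noteq> {}"
        unfolding S_def using n by (auto simp: gadget_flips lessThan_empty_iff)
      ultimately show ?thesis
        using that[of "fst p" "snd p"] by simp
    qed
    ultimately show ?thesis
      using link_lift[of c u v] flips_lift[of c u v] by metis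
  qed
  moreover have "inj (place e) \<and> snd (dst e) = sym_diff (snd (src e)) {..<n + 2} \<and>
        (src e, dst e) \<in> ?R ^^ (n + 2)" if e: "e \<in> C'" for e
  proof -
    obtain c g where c: "c \<in> C" and g: "g \<in> set (gadget_cells n)" "e = lift_piece c g"
      using e by (auto simp: C'_def)
    have "snd (dst g) = sym_diff (snd (src g)) {..<n + 2}"
      using g(1) by (auto simp: gadget_cells_def gadget_vertex_defs)
    then have "snd (dst e) = sym_diff (snd (src e)) {..<n + 2}"
      by (cases g) (auto simp: g(2) lift_def)
    moreover have "(src e, dst e) \<in> ?R ^^ (n + 2)"
    proof -
      have "e \<in> lift_piece c ` set (gadget_cells n)" using g by blast
      then show ?thesis using N[OF c] unfolding cells_of[OF c] by (auto simp del: relpow.simps place.simps)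
    qed
    ultimately show ?thesis
      using inj_place_lift_piece[OF inj[OF c]] gadget_cells_inj g by blast
  qed
  moreover have "snd ` (\<Union>c\<in>C'. ends c) = Pow {..<n + 2}"
  proof
    show "snd ` (\<Union>c\<in>C'. ends c) \<subseteq> Pow {..<n + 2}"
    proof
      fix W assume "W \<in> snd ` (\<Union>c\<in>C'. ends c)"
      then obtain e w where e: "e \<in> C'" "w \<in> ends e" and W: "W = snd w"
        by blast
      obtain c g where c: "c \<in> C" and g: "g \<in> set (gadget_cells n)" "e = lift_piece c g"
        using e by (auto simp: C'_def)
      obtain q where q: "q \<in> ends g" "w = lift c q"
        using e(2) by (cases g) (auto simp: g(2))
      have "src c \<in> ends c" by (cases c) auto
      then have "snd (src c) \<subseteq> {..<n}" using labels c by blast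
      moreover have "snd q \<subseteq> {..<n + 2}"
        using q(1) g(1) by (auto simp: gadget_cells_def gadget_vertex_defs)
      ultimately show "W \<in> Pow {..<n + 2}"
        by (auto simp: W q(2) lift_def)
    qed
    show "Pow {..<n + 2} \<subseteq> snd ` (\<Union>c\<in>C'. ends c)"
    proof
      fix W assume W: "W \<in> Pow {..<n + 2}"
      \<comment> \<open>Without the two new elements \<open>W\<close> is the label of an end of some
        old cell. The four vertices derived from that end carry the extensions of \<open>S\<close>
        by new elements.\<close>
      define S where "S = W \<inter> {..<n}"
      have "S \<in> snd ` (\<Union>c\<in>C. ends c)" using labels by (auto simp: S_def)
      then obtain c where c: "c \<in> C" "S = snd (src c) \<or> S = snd (dst c)"
        by (auto simp: S_def)
      define E where "E = (\<Union>e\<in>lift_piece c ` set (gadget_cells n). ends e)"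
      have E: "lift c ` {gx, gxb n, gxc n, gxbc n, gy n, gyb n, gyc n, gybc n} \<subseteq> E"
        by (auto simp: E_def gadget_cells_def)
      have top: "W = S \<or> W = insert n S \<or> W = insert (Suc n) S \<or> W = insert n (insert (Suc n) S)"
      proof -
        have "j < n \<or> j = n \<or> j = Suc n" if "j \<in> W" for j
          using W that by fastforce
        then show ?thesis unfolding S_def by blast
      qed
      have "S \<subseteq> {..<n}" by (simp add: S_def)
      have "W \<in> snd ` lift c ` {gx, gxb n, gxc n, gxbc n, gy n, gyb n, gyc n, gybc n}"
        using c(2)
      proof
        assume S: "S = snd (src c)"
        have "snd (lift c gx) = S" "snd (lift c (gxb n)) = insert n S" "snd (lift c (gxc n)) = insert (Suc n) S"
          "snd (lift c (gxbc n)) = insert n (insert (Suc n) S)"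
          using \<open>S \<subseteq> {..<n}\<close> by (auto simp: lift_def gadget_vertex_defs S)
        then show ?thesis using top by auto
      next
        assume "S = snd (dst c)"
        then have S: "S = sym_diff (snd (src c)) {..<n}" using label[OF c(1)] by simp
        have "n \<notin> snd (src c)" "Suc n \<notin> snd (src c)"
          using \<open>S \<subseteq> {..<n}\<close> S by auto
        then have "snd (lift c (gy n)) = S" "snd (lift c (gyb n)) = insert n S" "snd (lift c (gyc n)) = insert (Suc n) S"
          "snd (lift c (gybc n)) = insert n (insert (Suc n) S)"
          by (auto simp: lift_def gadget_vertex_defs S)
        then show ?thesis using top by auto
      qed
      then have "W \<in> snd ` E" using E by blast
      then show "W \<in> snd ` (\<Union>c\<in>C'. ends c)"
        using c(1) unfolding E_def C'_def by blast
    qed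
  qed
  moreover have "joined ?R (2 * (n + 2) - 2) (src e) (dst e) (src f) (dst f) \<and>
        joined ?R (2 * (n + 2) - 2) (src e) (dst e) (dst f) (src f)"
    if ef: "e \<in> C'" "f \<in> C'" "e \<noteq> f" for e f
  proof -
    obtain c d where c: "c \<in> C" "e \<in> lift_piece c ` set (gadget_cells n)"
      and d: "d \<in> C" "f \<in> lift_piece d ` set (gadget_cells n)"
      using ef(1,2) unfolding C'_def by blast
    let ?Q = "\<lambda>a b. joined ?R (2 * n + 2) (src a) (dst a) (src b) (dst b) \<and> joined ?R (2 * n + 2) (src a) (dst a) (dst b) (src b)"
    have near_e: "joined ?R 2 (src e) (dst e) (src c) (dst c)"
      using N[OF c(1)] c(2) unfolding cells_of[OF c(1)] by (auto simp del: relpow.simps place.simps)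
    have "joined ?R 2 (src f) (dst f) (src d) (dst d)"
      using N[OF d(1)] d(2) unfolding cells_of[OF d(1)] by (auto simp del: relpow.simps place.simps)
    then have near_f: "joined ?R 2 (src d) (dst d) (src f) (dst f)"
      by (rule joined_sym[OF sym])
    have "?Q e f"
    proof (cases "c = d")
      case True
      have sorted: "sorted_wrt ?Q [(src c, lift c (gybc n), place c (Complex 2 1)), (lift c (gxb n), lift c (gyc n), place c (Complex 4 2)),
       (lift c (gxc n), lift c (gyb n), place c (Complex 8 8)), (lift c (gxbc n), dst c, place c (Complex 14 4))]"
        using Q[OF c(1)] by (simp del: place.simps)
      have Q_sym: "?Q b a" if ab: "?Q a b" for a b
        using joined_sym[OF sym conjunct1[OF ab]] joined_swap[OF joined_sym[OF sym conjunct2[OF ab]]] ..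
      from sorted_wrt_pairwise[OF sorted Q_sym, of e f] show ?thesis
        using c(2) d(2) ef(3) unfolding True[symmetric] cells_of[OF c(1)] by (simp del: place.simps)
    next
      case False
      have "joined ?R (2 * n - 2) (src c) (dst c) (src d) (dst d)" "joined ?R (2 * n - 2) (src c) (dst c) (dst d) (src d)"
        using join[OF c(1) d(1) False] joined_mono[OF mono order_refl] by blast+
      then have "joined ?R (2 + (2 * n - 2) + 2) (src e) (dst e) (src f) (dst f)"
        "joined ?R (2 + (2 * n - 2) + 2) (src e) (dst e) (dst f) (src f)"
        using joined_trans[OF joined_trans[OF near_e] near_f]
          joined_trans[OF joined_trans[OF near_e] joined_swap[OF near_f]] by blast+
      moreover have "2 + (2 * n - 2) + 2 = 2 * n + 2" using n by linarith
      ultimately show ?thesis by simp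
    qed
    moreover have "2 * (n + 2) - 2 = 2 * n + 2" by simp
    ultimately show ?thesis by simp
  qed
  ultimately show ?thesis
    unfolding stage_def by simp
qed

section \<open>The base case and planarity\<close>

text \<open>The graph \<open>K\<^sub>4\<close> for \<open>n = 2\<close>: a 4-cycle of links flipping
  \<open>0\<close> and \<open>1\<close> alternately, with its diagonals as cells.
  \<open>base_y\<close> lies inside the triangle of the other three vertices, and the cell triangle
  on \<open>base_z\<close> and \<open>base_w\<close> lies in the outer face.\<close>

definition "base_x = (Complex 0 4, {} :: nat set)"
definition "base_y = (Complex 0 1, {0, 1 :: nat})"
definition "base_z = (Complex (- 3) 0, {0 :: nat})"
definition "base_w = (Complex 3 0, {1 :: nat})"

lemmas base_vertex_defs = base_x_def base_y_def base_z_def base_w_def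

definition base_links :: "piece list" where
  "base_links = [link base_x base_z, link base_z base_y, link base_y base_w, link base_w base_x]"

definition base_cells :: "piece list" where
  "base_cells = [(base_x, base_y, Complex 1 2), (base_z, base_w, Complex 0 (- 1))]"

lemma base_drawn: "drawn (set base_links \<union> set base_cells)"
proof -
  have sorted: "sorted_wrt meet_at_ends (base_links @ base_cells)"
    unfolding base_links_def base_cells_def
    apply (simp add: link_def del: region.simps)
    apply (intro conjI)
    apply (simp_all add: meet_at_ends_def subset_iff Int_insert_left base_vertex_defs
        complex_eq_iff region_iff del: region.simps)
    apply safe
    apply linarith+
    done
  have "meet_at_ends a b" if "a \<in> set (base_links @ base_cells)"
      "b \<in> set (base_links @ base_cells)" "a \<noteq> b" for a b
    by (rule sorted_wrt_pairwise[OF sorted meet_at_ends_sym that])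
  moreover have "\<forall>a\<in>set (base_links @ base_cells). fst (src a) \<noteq> fst (dst a)"
    by (auto simp: base_links_def base_cells_def link_def base_vertex_defs)
  ultimately show ?thesis
    unfolding drawn_def set_append by blast
qed

lemma base_stage: "stage 2 (set base_links) (set base_cells)"
proof -
  let ?R = "steps (set base_links)"
  have two: "{..<2::nat} = {0, 1}" by auto
  have fl: "flips base_x base_z = {0}" "flips base_z base_y = {1}" "flips base_y base_w = {0}" "flips base_w base_x = {1}"
    by (auto simp: flips_def base_vertex_defs)
  have link1: "(u, v) \<in> ?R" if "link u v \<in> set base_links" "flips u v = {j}" for u v j
    using link_walk[OF that(1)] unfolding that(2) by (simp add: relpow_1[unfolded One_nat_def] del: relpow.simps)
  have R: "(base_x, base_z) \<in> ?R" "(base_z, base_y) \<in> ?R" "(base_y, base_w) \<in> ?R" "(base_w, base_x) \<in> ?R"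
    by (rule link1[OF _ fl(1)] link1[OF _ fl(2)] link1[OF _ fl(3)] link1[OF _ fl(4)], simp add: base_links_def)+
  note R' = R[THEN symD[OF sym_steps]]
  have j: "joined ?R 2 a b a' b'" if "(a, a') \<in> ?R" "(b, b') \<in> ?R" for a b a' b'
    by (rule joinedI[of a a' 1 _ b b' 1]) (use that in simp_all)
  have w2: "(a, c) \<in> ?R ^^ 2" if "(a, b) \<in> ?R" "(b, c) \<in> ?R" for a b c
    using that by (auto simp: numeral_2_eq_2)
  have "\<forall>l\<in>set base_links. \<exists>u v. l = link u v \<and> flips u v \<subseteq> {..<2} \<and> flips u v \<noteq> {}"
  proof
    fix l assume "l \<in> set base_links"
    then have "l = link base_x base_z \<or> l = link base_z base_y \<or> l = link base_y base_w \<or> l = link base_w base_x"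
      by (simp add: base_links_def)
    moreover have "flips base_x base_z \<subseteq> {..<2} \<and> flips base_x base_z \<noteq> {}" "flips base_z base_y \<subseteq> {..<2} \<and> flips base_z base_y \<noteq> {}"
      "flips base_y base_w \<subseteq> {..<2} \<and> flips base_y base_w \<noteq> {}" "flips base_w base_x \<subseteq> {..<2} \<and> flips base_w base_x \<noteq> {}"
      by (simp_all add: fl)
    ultimately show "\<exists>u v. l = link u v \<and> flips u v \<subseteq> {..<2} \<and> flips u v \<noteq> {}"
      by metis
  qed
  moreover have "\<forall>c\<in>set base_cells. inj (place c) \<and> snd (dst c) = sym_diff (snd (src c)) {..<2} \<and>
        (src c, dst c) \<in> ?R ^^ 2"
  proof -
    have "inj (place (base_x, base_y, Complex 1 2))" "inj (place (base_z, base_w, Complex 0 (- 1)))"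
      by (rule inj_place, simp add: base_vertex_defs)+
    moreover have "snd base_y = sym_diff (snd base_x) {..<2}" "snd base_w = sym_diff (snd base_z) {..<2}"
      unfolding two by (auto simp: base_vertex_defs)
    ultimately show ?thesis
      using w2[OF R(1) R(2)] w2[OF R(2) R(3)] unfolding base_cells_def by simp
  qed
  moreover have "snd ` (\<Union>c\<in>set base_cells. ends c) = Pow {..<2}"
    unfolding two by (auto simp: base_cells_def base_vertex_defs Pow_insert)
  \<comment> \<open>Ends of different cells are neighbours on the 4-cycle, so every pairing has
    total length 1 + 1, which is the bound for \<open>n = 2\<close>.\<close>
  moreover have "\<forall>c\<in>set base_cells. \<forall>d\<in>set base_cells. c \<noteq> d \<longrightarrow>
        joined ?R (2 * 2 - 2) (src c) (dst c) (src d) (dst d) \<and>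
        joined ?R (2 * 2 - 2) (src c) (dst c) (dst d) (src d)"
    using j[OF R(1) R(3)] j[OF R'(4) R'(2)] j[OF R'(1) R'(3)] j[OF R(2) R(4)] by (simp add: base_cells_def)
  ultimately show ?thesis
    unfolding stage_def using base_drawn by simp
qed

lemma stage_exists: "1 \<le> k \<Longrightarrow> \<exists>L C. stage (2 * k) L C"
proof (induction k rule: dec_induct)
  case base
  then show ?case using base_stage by auto
next
  case (step k)
  then obtain L C where st: "stage (2 * k) L C" by blast
  have "2 * Suc k = 2 * k + 2" "2 \<le> 2 * k" using step.hyps by simp_all
  then show ?case using stage_step[OF st] by metis
qed

section \<open>Straight-line drawings of links and of the whole graph\<close>

lemma linepath_eq_iff:
  fixes a b :: complex
  assumes "a \<noteq> b"
  shows "linepath a b s = linepath a b t \<longleftrightarrow> s = t"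
proof -
  have "linepath a b s - linepath a b t = (s - t) *\<^sub>R (b - a)"
    unfolding linepath_def scaleR_diff_left scaleR_diff_right by simp
  then have "linepath a b s = linepath a b t \<longleftrightarrow> (s - t) *\<^sub>R (b - a) = 0"
    by (metis eq_iff_diff_eq_0)
  then show ?thesis
    using assms by simp
qed

lemma subsegment_linepath:
  fixes a b :: complex
  assumes "z \<in> closed_segment (linepath a b s) (linepath a b t)" "s \<le> t"
  obtains r where "s \<le> r" "r \<le> t" "z = linepath a b r"
proof -
  obtain u where u: "0 \<le> u" "u \<le> 1" "z = (1 - u) *\<^sub>R linepath a b s + u *\<^sub>R linepath a b t"
    using assms(1) by (auto simp: closed_segment_def)
  have "z = linepath a b (s + u * (t - s))"
    unfolding u(3) linepath_def by (simp add: complex_eq_iff) (simp add: algebra_simps)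
  moreover have "0 \<le> u * (t - s)" "u * (t - s) \<le> 1 * (t - s)"
    using u(1,2) assms(2) by (intro mult_nonneg_nonneg mult_right_mono; simp)+
  ultimately show ?thesis
    by (intro that[of "s + u * (t - s)"]) simp_all
qed

lemma link_edge_segment:
  assumes "m = card (flips u v)" "i < m" "z \<in> convex hull (fst ` {waypoint u v i, waypoint u v (Suc i)})"
  obtains r where "real i / real m \<le> r" "r \<le> real (Suc i) / real m" "z = linepath (fst u) (fst v) r"
proof -
  have "z \<in> closed_segment (linepath (fst u) (fst v) (real i / real m)) (linepath (fst u) (fst v) (real (Suc i) / real m))"
    using assms(1,3) by (simp add: waypoint_def segment_convex_hull)
  moreover have "real i / real m \<le> real (Suc i) / real m"
    by (simp add: divide_right_mono)
  ultimately show ?thesis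
    using subsegment_linepath that by blast
qed

definition separated :: "vertex set set \<Rightarrow> bool" where
  "separated F \<longleftrightarrow> (\<forall>e\<in>F. \<forall>e'\<in>F. e \<noteq> e' \<longrightarrow>
     convex hull (fst ` e) \<inter> convex hull (fst ` e') \<subseteq> fst ` (e \<inter> e'))"

text \<open>Edge number \<open>i\<close> occupies the parameters from \<open>i / m\<close> to
  \<open>(i + 1) / m\<close> of an injectively parametrised segment, so contacts are read off these
  intervals. The three claims are what \<open>separated_pieces\<close> asks of a link.\<close>

lemma link_edges_drawn:
  assumes neq: "fst u \<noteq> fst v" and fl: "finite (flips u v)" "flips u v \<noteq> {}"
  shows "e \<in> link_edges (link u v) \<Longrightarrow> convex hull (fst ` e) \<subseteq> region (link u v)"
    and "e \<in> link_edges (link u v) \<Longrightarrow> w \<in> ends (link u v) \<Longrightarrow> fst w \<in> convex hull (fst ` e) \<Longrightarrow> w \<in> e"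
    and "separated (link_edges (link u v))"
proof -
  define m where "m = card (flips u v)"
  have m: "0 < m" using fl by (simp add: m_def card_gt_0_iff)
  have edge: "\<exists>i<m. e = {waypoint u v i, waypoint u v (Suc i)}" if "e \<in> link_edges (link u v)" for e
    using that unfolding m_def link_def link_edges.simps by blast
  have fst_wp: "fst (waypoint u v i) = linepath (fst u) (fst v) (real i / real m)" for i
    by (simp add: waypoint_def m_def)
  show "convex hull (fst ` e) \<subseteq> region (link u v)" if e: "e \<in> link_edges (link u v)"
  proof
    fix z assume z: "z \<in> convex hull (fst ` e)"
    obtain i where i: "i < m" "e = {waypoint u v i, waypoint u v (Suc i)}" using edge[OF e] by blast
    obtain r where r: "real i / real m \<le> r" "r \<le> real (Suc i) / real m" "z = linepath (fst u) (fst v) r"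
      using link_edge_segment[OF m_def i(1)] z i(2) by blast
    have "0 \<le> r"
      by (rule order_trans[OF _ r(1)]) simp
    moreover have "r \<le> 1"
      by (rule order_trans[OF r(2)]) (use i(1) in simp)
    ultimately have "r \<in> {0..1}"
      by simp
    then have "z \<in> closed_segment (fst u) (fst v)"
      unfolding r(3) by (rule linepath_in_path)
    moreover have "{fst u, fst v, fst u} = {fst u, fst v}" by blast
    ultimately show "z \<in> region (link u v)"
      by (simp add: link_def segment_convex_hull)
  qed
  show "w \<in> e" if e: "e \<in> link_edges (link u v)" and w: "w \<in> ends (link u v)" "fst w \<in> convex hull (fst ` e)"
  proof -
    obtain i where i: "i < m" "e = {waypoint u v i, waypoint u v (Suc i)}" using edge[OF e] by blast
    obtain r where r: "real i / real m \<le> r" "r \<le> real (Suc i) / real m" "fst w = linepath (fst u) (fst v) r"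
      using link_edge_segment[OF m_def i(1)] w(2) i(2) by blast
    consider "w = u" | "w = v" using w(1) by (auto simp: link_def)
    then show ?thesis
    proof cases
      case 1
      have "linepath (fst u) (fst v) r = linepath (fst u) (fst v) 0"
        using r(3) 1 by (simp add: linepath_0')
      then have "r = 0" using linepath_eq_iff[OF neq] by blast
      then have "i = 0" using r(1) m by (simp add: divide_le_0_iff)
      then show ?thesis using 1 i(2) waypoint_0 by simp
    next
      case 2
      have "linepath (fst u) (fst v) r = linepath (fst u) (fst v) 1"
        using r(3) 2 by (simp add: linepath_1')
      then have "r = 1" using linepath_eq_iff[OF neq] by blast
      then have "Suc i = m" using r(2) m i(1) by (simp add: field_simps)
      then show ?thesis using 2 i(2) waypoint_card[OF fl] by (simp add: m_def)
    qed
  qed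
  have less: "convex hull (fst ` {waypoint u v i, waypoint u v (Suc i)}) \<inter>
      convex hull (fst ` {waypoint u v j, waypoint u v (Suc j)})
      \<subseteq> fst ` ({waypoint u v i, waypoint u v (Suc i)} \<inter> {waypoint u v j, waypoint u v (Suc j)})"
    if ij: "i < j" "j < m" for i j
  proof
    fix z assume z: "z \<in> convex hull (fst ` {waypoint u v i, waypoint u v (Suc i)}) \<inter>
      convex hull (fst ` {waypoint u v j, waypoint u v (Suc j)})"
    have "i < m" using ij by simp
    obtain r where r: "r \<le> real (Suc i) / real m" "z = linepath (fst u) (fst v) r"
      using link_edge_segment[OF m_def \<open>i < m\<close>] z by blast
    obtain s where s: "real j / real m \<le> s" "z = linepath (fst u) (fst v) s"
      using link_edge_segment[OF m_def ij(2)] z by blast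
    have "s = r" using r(2) s(2) linepath_eq_iff[OF neq] by simp
    then have "real j / real m \<le> real (Suc i) / real m" using r s by linarith
    then have "j \<le> Suc i" using m by (simp add: divide_le_cancel)
    then have j: "j = Suc i" using ij by simp
    then have "r = real j / real m" using r s \<open>s = r\<close> by simp
    then have "z = fst (waypoint u v j)" using r(2) fst_wp by simp
    then show "z \<in> fst ` ({waypoint u v i, waypoint u v (Suc i)} \<inter> {waypoint u v j, waypoint u v (Suc j)})"
      using j by blast
  qed
  show "separated (link_edges (link u v))"
    unfolding separated_def
  proof (intro ballI impI)
    fix e e' assume e: "e \<in> link_edges (link u v)" "e' \<in> link_edges (link u v)" "e \<noteq> e'"
    obtain i where i: "i < m" "e = {waypoint u v i, waypoint u v (Suc i)}" using edge[OF e(1)] by blast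
    obtain j where j: "j < m" "e' = {waypoint u v j, waypoint u v (Suc j)}" using edge[OF e(2)] by blast
    consider "i < j" | "j < i" | "i = j" by linarith
    then show "convex hull (fst ` e) \<inter> convex hull (fst ` e') \<subseteq> fst ` (e \<inter> e')"
    proof cases
      case 1
      show ?thesis unfolding i(2) j(2) by (rule less[OF 1 j(1)])
    next
      case 2
      show ?thesis unfolding i(2) j(2) using less[OF 2 i(1)] by (simp only: Int_commute)
    next
      case 3 then show ?thesis using e(3) i j by simp
    qed
  qed
qed

text \<open>\<open>F a\<close> holds the edges drawn inside piece \<open>a\<close>. Edges of
  different pieces touch only at a common end of the pieces, and \<open>corner\<close> puts that
  vertex on both edges.\<close>

lemma separated_pieces:
  assumes drawn: "drawn P"
    and sub: "\<And>a e. a \<in> P \<Longrightarrow> e \<in> F a \<Longrightarrow> convex hull (fst ` e) \<subseteq> region a"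
    and corner: "\<And>a e w. a \<in> P \<Longrightarrow> e \<in> F a \<Longrightarrow> w \<in> ends a \<Longrightarrow> fst w \<in> convex hull (fst ` e) \<Longrightarrow> w \<in> e"
    and sep: "\<And>a. a \<in> P \<Longrightarrow> separated (F a)"
  shows "separated (\<Union>a\<in>P. F a)"
  unfolding separated_def
proof (intro ballI impI)
  fix e e' assume e: "e \<in> (\<Union>a\<in>P. F a)" "e' \<in> (\<Union>a\<in>P. F a)" "e \<noteq> e'"
  obtain a where a: "a \<in> P" "e \<in> F a" using e by blast
  obtain b where b: "b \<in> P" "e' \<in> F b" using e by blast
  show "convex hull (fst ` e) \<inter> convex hull (fst ` e') \<subseteq> fst ` (e \<inter> e')"
  proof (cases "a = b")
    case True
    then show ?thesis using sep[OF a(1)] a b e(3) unfolding separated_def by blast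
  next
    case False
    then have "meet_at_ends a b" using drawn a(1) b(1) unfolding drawn_def by blast
    show ?thesis
    proof
      fix z assume z: "z \<in> convex hull (fst ` e) \<inter> convex hull (fst ` e')"
      then have "z \<in> region a \<inter> region b" using sub[OF a] sub[OF b] by blast
      then obtain w where "w \<in> ends a" "w \<in> ends b" "z = fst w"
        using \<open>meet_at_ends a b\<close> unfolding meet_at_ends_def by blast
      then show "z \<in> fst ` (e \<inter> e')" using corner[OF a] corner[OF b] z by blast
    qed
  qed
qed

text \<open>As every vertex lies on an edge, \<open>sep\<close> and the distinct end positions also
  keep vertices apart from each other and off foreign edges.\<close>

lemma planar_straight:
  fixes pos :: "'a \<Rightarrow> complex"
  assumes edges: "\<And>e. e \<in> E \<Longrightarrow> \<exists>u v. e = {u, v} \<and> pos u \<noteq> pos v" and V: "V = \<Union>E"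
    and sep: "\<And>e e'. e \<in> E \<Longrightarrow> e' \<in> E \<Longrightarrow> e \<noteq> e' \<Longrightarrow>
      convex hull (pos ` e) \<inter> convex hull (pos ` e') \<subseteq> pos ` (e \<inter> e')"
  shows "planar V E"
proof -
  have on: "pos u \<in> convex hull (pos ` e)" if "u \<in> e" for u e
    using that by (simp add: hull_inc)
  have inj_edge: "u = v" if "e \<in> E" "u \<in> e" "v \<in> e" "pos u = pos v" for e u v
    using edges[OF that(1)] that by auto
  have inj: "inj_on pos V"
  proof (rule inj_onI)
    fix u v assume uv: "u \<in> V" "v \<in> V" "pos u = pos v"
    obtain e where e: "e \<in> E" "u \<in> e" using uv V by blast
    obtain f where f: "f \<in> E" "v \<in> f" using uv V by blast
    show "u = v"
    proof (cases "e = f")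
      case True
      then show ?thesis using inj_edge[OF e(1)] e f uv by blast
    next
      case False
      have "pos u \<in> convex hull (pos ` e) \<inter> convex hull (pos ` f)"
        using on[OF e(2)] on[OF f(2)] uv(3) by simp
      then obtain w where "w \<in> e" "w \<in> f" "pos u = pos w" using sep[OF e(1) f(1) False] by blast
      then show ?thesis using inj_edge[OF e(1) e(2)] inj_edge[OF f(1) f(2)] uv(3) by metis
    qed
  qed
  \<comment> \<open>An edge is an unordered pair, so one of its two orientations has to be
    chosen.\<close>
  define arc_of where "arc_of e = (SOME \<gamma>. \<exists>u v. e = {u, v} \<and> pos u \<noteq> pos v \<and> \<gamma> = linepath (pos u) (pos v))" for e
  have arc_of: "\<exists>u v. e = {u, v} \<and> pos u \<noteq> pos v \<and> arc_of e = linepath (pos u) (pos v)" if e: "e \<in> E" for e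
  proof -
    obtain u v where uv: "e = {u, v}" "pos u \<noteq> pos v"
      using edges[OF e] by blast
    then have ex: "\<exists>\<gamma> u v. e = {u, v} \<and> pos u \<noteq> pos v \<and> \<gamma> = linepath (pos u) (pos v)"
      by (intro exI[of _ "linepath (pos u) (pos v)"] exI[of _ u] exI[of _ v]) simp
    show ?thesis
      unfolding arc_of_def by (rule someI_ex[OF ex])
  qed
  have image: "path_image (arc_of e) = convex hull (pos ` e)" if e: "e \<in> E" for e
  proof -
    obtain u v where uv: "e = {u, v}" "arc_of e = linepath (pos u) (pos v)"
      using arc_of[OF e] by blast
    have "pos ` e = {pos u, pos v}"
      using uv(1) by simp
    then show ?thesis
      unfolding uv(2) path_image_linepath segment_convex_hull by simp
  qed
  have arcs: "arc (arc_of e) \<and> {pathstart (arc_of e), pathfinish (arc_of e)} = pos ` e \<and>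
      path_image (arc_of e) \<inter> pos ` V = pos ` e" if e: "e \<in> E" for e
  proof -
    have "path_image (arc_of e) \<inter> pos ` V \<subseteq> pos ` e"
    proof
      fix z assume z: "z \<in> path_image (arc_of e) \<inter> pos ` V"
      then obtain v f where v: "z = pos v" "v \<in> f" "f \<in> E" using V by blast
      show "z \<in> pos ` e"
      proof (cases "e = f")
        case False
        have "z \<in> convex hull (pos ` e)" using z image[OF e] by simp
        moreover have "z \<in> convex hull (pos ` f)" using on[OF v(2)] v(1) by simp
        ultimately have "z \<in> pos ` (e \<inter> f)" using subsetD[OF sep[OF e v(3) False] IntI] by blast
        then show ?thesis by blast
      qed (use v in blast)
    qed
    moreover have "pos ` e \<subseteq> path_image (arc_of e) \<inter> pos ` V"
    proof
      fix z assume "z \<in> pos ` e"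
      then obtain w where w: "z = pos w" "w \<in> e" by blast
      have "w \<in> V" using w(2) V e by blast
      then show "z \<in> path_image (arc_of e) \<inter> pos ` V"
        unfolding image[OF e] w(1) using on[OF w(2)] by simp
    qed
    moreover have "arc (arc_of e) \<and> {pathstart (arc_of e), pathfinish (arc_of e)} = pos ` e"
    proof -
      obtain u v where uv: "e = {u, v}" "pos u \<noteq> pos v" "arc_of e = linepath (pos u) (pos v)"
        using arc_of[OF e] by blast
      show ?thesis
        unfolding uv(3) using uv(1,2) by (simp add: arc_linepath)
    qed
    ultimately show ?thesis by blast
  qed
  have crossings: "path_image (arc_of e) \<inter> path_image (arc_of e') \<subseteq> pos ` (e \<inter> e')"
    if "e \<in> E" "e' \<in> E" "e \<noteq> e'" for e e'
    using sep[OF that] image that by simp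
  show ?thesis
    unfolding planar_def
    by (intro exI[of _ pos] exI[of _ arc_of] conjI[OF inj] conjI ballI impI) (use arcs crossings in simp_all)
qed

section \<open>Odd walks, odd cycles and labels\<close>

definition adj :: "'a set set \<Rightarrow> 'a rel" where
  "adj E = {(p, q). {p, q} \<in> E}"

lemma sym_adj: "sym (adj E)"
  unfolding adj_def sym_def by (simp add: insert_commute)

lemma steps_eq_adj: "steps L = adj (\<Union>l\<in>L. link_edges l)"
  unfolding steps_def adj_def by blast

text \<open>A walk of odd length has a first edge; running it back and forth adds any even number of
  steps.\<close>

lemma pad_walk:
  assumes sym: "sym A" and walk: "(a, b) \<in> A ^^ m" and m: "odd m" "m \<le> m'" "odd m'"
  shows "(a, b) \<in> A ^^ m'"
proof -
  have "even (m' - m)" using m by simp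
  then obtain i where "m' - m = 2 * i" by (rule evenE)
  then obtain j where j: "m' = 2 * j + m" using m(2) that[of i] by linarith
  obtain i where "m = Suc i" using m(1) by (cases m) auto
  then obtain c where c: "(a, c) \<in> A" using relpow_Suc_D2[of a b i A] walk by auto
  have "(a, a) \<in> A ^^ Suc (Suc 0)"
    by (rule relpow_Suc_I[OF relpow_Suc_I[OF relpow_0_I c] symD[OF sym c]])
  then have "(a, a) \<in> A ^^ 2"
    unfolding numeral_2_eq_2 .
  then have "(a, a) \<in> A ^^ (2 * j)"
  proof (induction j)
    case (Suc j)
    have "(a, a) \<in> A ^^ (2 + 2 * j)" by (rule relpow_trans[OF Suc.prems Suc.IH[OF Suc.prems]])
    then show ?case by (simp del: relpow.simps)
  qed simp
  then show ?thesis unfolding j using walk by (rule relpow_trans)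
qed

text \<open>\<open>par\<close> is a two-colouring that fixes the parity of ordinary walks. For equal
  colours the crossed pairing gives even walks, to be completed by one cell edge; for different
  colours the straight pairing gives odd walks, taken directly or between two cell edges.\<close>

lemma short_odd_walk:
  assumes sym: "sym A" and sub: "R \<subseteq> A" and xy: "(x, y) \<in> A" and wv: "(w, v) \<in> A"
    and n: "even n" "2 \<le> n"
    and par: "\<And>p q m. (p, q) \<in> R ^^ m \<Longrightarrow> even m \<longleftrightarrow> (par p \<longleftrightarrow> par q)"
      "par x \<longleftrightarrow> par y" "par w \<longleftrightarrow> par v"
    and straight: "joined R (2 * n - 2) x y w v" and crossed: "joined R (2 * n - 2) x y v w"
  shows "(x, w) \<in> A ^^ (n - 1)"
proof -
  have A1: "(x, y) \<in> A ^^ 1" "(w, v) \<in> A ^^ 1" "(v, w) \<in> A ^^ 1"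
    using xy wv symD[OF sym wv] by simp_all
  have RA: "(p, q) \<in> A ^^ m" if "(p, q) \<in> R ^^ m" for p q m
    using relpow_mono[OF sub] that by blast
  have odd_n: "odd (n - 1)" using n by simp
  note pad = pad_walk[OF sym _ _ _ odd_n]
  obtain p q where pq: "(x, w) \<in> R ^^ p" "(y, v) \<in> R ^^ q" "p + q \<le> 2 * n - 2"
    using straight unfolding joined_def by blast
  obtain p' q' where pq': "(x, v) \<in> R ^^ p'" "(y, w) \<in> R ^^ q'" "p' + q' \<le> 2 * n - 2"
    using crossed unfolding joined_def by blast
  show ?thesis
  proof (cases "par x \<longleftrightarrow> par w")
    case True
    then have ev: "even p'" "even q'" using par(1)[OF pq'(1)] par(1)[OF pq'(2)] par(2,3) by blast+
    have "p' \<le> n - 1 \<or> q' \<le> n - 1" using pq'(3) n by linarith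
    \<comment> \<open>As \<open>n - 1\<close> is odd, an even length within it leaves room for one
      cell edge.\<close>
    moreover have "p' \<noteq> n - 1" "q' \<noteq> n - 1" using ev odd_n by blast+
    ultimately have "p' + 1 \<le> n - 1 \<or> q' + 1 \<le> n - 1" by linarith
    then show ?thesis
    proof
      assume "p' + 1 \<le> n - 1"
      then show ?thesis using pad[OF relpow_trans[OF RA[OF pq'(1)] A1(3)]] ev by simp
    next
      assume "q' + 1 \<le> n - 1"
      then show ?thesis using pad[OF relpow_trans[OF A1(1) RA[OF pq'(2)]]] ev by simp
    qed
  next
    case False
    then have od: "odd p" "odd q" using par(1)[OF pq(1)] par(1)[OF pq(2)] par(2,3) by blast+
    show ?thesis
    proof (cases "p \<le> n - 1")
      case True
      then show ?thesis using pad[OF RA[OF pq(1)] od(1)] by simp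
    next
      case False
      \<comment> \<open>Now \<open>p\<close> is at least \<open>n + 1\<close>, so \<open>q\<close>
        is at most \<open>n - 3\<close> and the detour through both cell edges fits.\<close>
      have "p \<noteq> n" using od n by blast
      then have "1 + q + 1 \<le> n - 1" using False pq(3) n(2) by linarith
      then show ?thesis
        using pad[OF relpow_trans[OF relpow_trans[OF A1(1) RA[OF pq(2)]] A1(3)]] od by simp
    qed
  qed
qed

section \<open>Labels along walks\<close>

lemma card_sym_diff_singleton:
  assumes "finite X"
  shows "card (sym_diff X {j}) \<le> Suc (card X)" "even (card (sym_diff X {j})) \<longleftrightarrow> odd (card X)"
proof -
  have "card (sym_diff X {j}) \<le> Suc (card X) \<and> (even (card (sym_diff X {j})) \<longleftrightarrow> odd (card X))"
  proof (cases "j \<in> X")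
    case True
    then have "sym_diff X {j} = X - {j}" by blast
    moreover have "card X = Suc (card (X - {j}))"
      by (rule card.remove[OF assms True])
    ultimately show ?thesis by simp
  next
    case False
    then have "sym_diff X {j} = insert j X" by blast
    then show ?thesis using assms False by simp
  qed
  then show "card (sym_diff X {j}) \<le> Suc (card X)" "even (card (sym_diff X {j})) \<longleftrightarrow> odd (card X)"
    by blast+
qed

text \<open>Here \<open>a\<close> counts the complementing steps and \<open>b\<close> the single flips.\<close>

lemma label_change:
  fixes lab :: "nat \<Rightarrow> nat set"
  assumes "\<And>i. i < m \<Longrightarrow> sym_diff (lab i) (lab (Suc i)) = {..<n} \<or>
      (\<exists>j<n. sym_diff (lab i) (lab (Suc i)) = {j})"
  shows "\<exists>X a b. a + b = m \<and> X \<subseteq> {..<n} \<and> card X \<le> b \<and> (even (card X) \<longleftrightarrow> even b) \<and>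
      sym_diff (lab 0) (lab m) = (if odd a then {..<n} - X else X)"
  using assms
proof (induction m)
  case 0
  show ?case by (intro exI[of _ "{} :: nat set"] exI[of _ "0 :: nat"] exI[of _ "0 :: nat"]) simp
next
  case (Suc m)
  have "\<exists>X a b. a + b = m \<and> X \<subseteq> {..<n} \<and> card X \<le> b \<and> (even (card X) \<longleftrightarrow> even b) \<and>
      sym_diff (lab 0) (lab m) = (if odd a then {..<n} - X else X)"
    by (rule Suc.IH) (rule Suc.prems, simp)
  then obtain X a b where X: "a + b = m" "X \<subseteq> {..<n}" "card X \<le> b" "even (card X) \<longleftrightarrow> even b"
      "sym_diff (lab 0) (lab m) = (if odd a then {..<n} - X else X)"
    by (elim exE conjE) (rule that)
  have fin: "finite X" using X(2) finite_subset by blast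
  have comp: "sym_diff (lab 0) (lab (Suc m)) = sym_diff (sym_diff (lab 0) (lab m)) (sym_diff (lab m) (lab (Suc m)))"
    by blast
  consider "sym_diff (lab m) (lab (Suc m)) = {..<n}" | j where "j < n" "sym_diff (lab m) (lab (Suc m)) = {j}"
    using Suc.prems by blast
  then show ?case
  proof cases
    case 1
    have "sym_diff (lab 0) (lab (Suc m)) = (if odd (Suc a) then {..<n} - X else X)"
      unfolding comp X(5) 1 using X(2) by auto
    then show ?thesis using X
      by (intro exI[of _ X] exI[of _ "Suc a"] exI[of _ b]) simp
  next
    case 2
    \<comment> \<open>\<open>X\<close> collects the elements that single flips have changed an odd
      number of times. A flip commutes with complementing, so it acts on \<open>X\<close> for either
      parity of \<open>a\<close>.\<close>
    have "sym_diff (lab 0) (lab (Suc m)) = (if odd a then {..<n} - sym_diff X {j} else sym_diff X {j})"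
      unfolding comp X(5) 2 using X(2) 2(1) by auto
    moreover have "sym_diff X {j} \<subseteq> {..<n}" using X(2) 2(1) by auto
    moreover have "card (sym_diff X {j}) \<le> Suc b" "even (card (sym_diff X {j})) \<longleftrightarrow> even (Suc b)"
      using card_sym_diff_singleton[OF fin, of j] X(3,4) by auto
    ultimately show ?thesis using X(1)
      by (intro exI[of _ "sym_diff X {j}"] exI[of _ a] exI[of _ "Suc b"]) simp
  qed
qed

text \<open>The label returns to itself. If \<open>a\<close> is odd, \<open>X\<close> must be all of
  \<open>{..<n}\<close>, so \<open>b\<close> is at least \<open>n\<close> and \<open>a\<close> at
  least 1. If \<open>a\<close> is even, \<open>X\<close> is empty, so \<open>b\<close> and hence
  \<open>l\<close> would be even.\<close>

lemma odd_cycle_length: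
  assumes lab: "\<And>p q. {p, q} \<in> E \<Longrightarrow> sym_diff (lab p) (lab q) = {..<n} \<or> (\<exists>j<n. sym_diff (lab p) (lab q) = {j})"
    and n: "even n" and cyc: "has_cycle_of_length V E l" "odd l"
  shows "n + 1 \<le> l"
proof -
  obtain c where c: "length c = l" "\<And>i. i < l \<Longrightarrow> {c ! i, c ! ((i + 1) mod l)} \<in> E"
    using cyc(1) unfolding has_cycle_of_length_def by blast
  \<comment> \<open>Reducing the index modulo \<open>l\<close> closes the walk, making
    \<open>f l\<close> equal to \<open>f 0\<close>.\<close>
  define f where "f i = lab (c ! (i mod l))" for i
  have step: "sym_diff (f i) (f (Suc i)) = {..<n} \<or> (\<exists>j<n. sym_diff (f i) (f (Suc i)) = {j})" if "i < l" for i
    using lab[OF c(2)[OF that]] that by (simp add: f_def)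
  have "\<exists>X a b. a + b = l \<and> X \<subseteq> {..<n} \<and> card X \<le> b \<and> (even (card X) \<longleftrightarrow> even b) \<and>
      sym_diff (f 0) (f l) = (if odd a then {..<n} - X else X)"
    by (rule label_change) (rule step)
  then obtain X a b where X: "a + b = l" "X \<subseteq> {..<n}" "card X \<le> b" "even (card X) \<longleftrightarrow> even b"
      "sym_diff (f 0) (f l) = (if odd a then {..<n} - X else X)"
    by (elim exE conjE) (rule that)
  have closed: "sym_diff (f 0) (f l) = {}" by (simp add: f_def)
  show ?thesis
  proof (cases "odd a")
    case True
    then have "X = {..<n}" using X(2,5) closed by auto
    then have "n \<le> b" using X(3) by simp
    moreover have "0 < a" using True by (rule odd_pos)
    ultimately show ?thesis using X(1) by linarith
  next
    case False
    then have "X = {}" using X(5) closed by simp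
    then have "even b" using X(4) by simp
    then show ?thesis using False X(1) cyc(2) by auto
  qed
qed

text \<open>Each ordinary edge changes the parity of the label, which gives the two-colouring behind
  \<open>short_odd_walk\<close>. Intersecting with \<open>{..<n}\<close> keeps the counted sets
  finite.\<close>

lemma relpow_flips:
  assumes single: "\<And>p q. (p, q) \<in> R \<Longrightarrow> \<exists>j<n. flips p q = {j}" and walk: "(p, q) \<in> R ^^ m"
  shows "finite (flips p q)" "card (flips p q) \<le> m"
    "even m \<longleftrightarrow> (even (card (snd p \<inter> {..<n})) \<longleftrightarrow> even (card (snd q \<inter> {..<n})))"
proof -
  have "finite (flips p q) \<and> card (flips p q) \<le> m \<and>
    (even m \<longleftrightarrow> (even (card (snd p \<inter> {..<n})) \<longleftrightarrow> even (card (snd q \<inter> {..<n}))))"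
    using walk
  proof (induction m arbitrary: q)
    case 0
    then show ?case by (simp add: flips_def)
  next
    case (Suc m)
    obtain r where r: "(p, r) \<in> R ^^ m" "(r, q) \<in> R" using Suc.prems by (rule relpow_Suc_E)
    note IH = Suc.IH[OF r(1)]
    obtain j where j: "j < n" "flips r q = {j}" using single[OF r(2)] by blast
    have flip: "flips p q = sym_diff (flips p r) {j}"
      using j(2) unfolding flips_def by blast
    have "snd q \<inter> {..<n} = sym_diff (snd r \<inter> {..<n}) {j}"
      using j unfolding flips_def by blast
    then have "even (card (snd q \<inter> {..<n})) \<longleftrightarrow> odd (card (snd r \<inter> {..<n}))"
      using card_sym_diff_singleton(2)[of "snd r \<inter> {..<n}" j] by simp
    moreover have "finite (flips p q) \<and> card (flips p q) \<le> Suc m"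
      unfolding flip using IH card_sym_diff_singleton(1)[of "flips p r" j] by auto
    ultimately show ?case using IH by auto
  qed
  then show "finite (flips p q)" "card (flips p q) \<le> m"
    "even m \<longleftrightarrow> (even (card (snd p \<inter> {..<n})) \<longleftrightarrow> even (card (snd q \<inter> {..<n})))" by blast+
qed

text \<open>Between two visits to one vertex the walk could be cut, leaving fewer than
  \<open>m\<close> steps for \<open>m\<close> flips.\<close>

lemma geodesic_distinct:
  assumes single: "\<And>p q. (p, q) \<in> R \<Longrightarrow> \<exists>j<n. flips p q = {j}"
    and f: "\<And>i. i < m \<Longrightarrow> (f i, f (Suc i)) \<in> R" and m: "card (flips (f 0) (f m)) = m"
  shows "inj_on f {..m}"
proof -
  have walk: "(f i, f j) \<in> R ^^ (j - i)" if "i \<le> j" "j \<le> m" for i j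
    unfolding relpow_fun_conv using f that by (intro exI[of _ "\<lambda>t. f (i + t)"]) simp
  have "f i \<noteq> f j" if ij: "i < j" "j \<le> m" for i j
  proof
    assume eq: "f i = f j"
    have 1: "finite (flips (f 0) (f i))" "card (flips (f 0) (f i)) \<le> i"
      using relpow_flips(1,2)[OF single walk[of 0 i]] ij by simp_all
    have 2: "finite (flips (f i) (f m))" "card (flips (f i) (f m)) \<le> m - j"
      using relpow_flips(1,2)[OF single walk[of j m]] ij eq by simp_all
    have sub: "flips (f 0) (f m) \<subseteq> flips (f 0) (f i) \<union> flips (f i) (f m)"
      unfolding flips_def by blast
    have "m \<le> card (flips (f 0) (f i) \<union> flips (f i) (f m))"
      using card_mono[OF finite_UnI[OF 1(1) 2(1)] sub] m by simp
    also have "\<dots> \<le> i + (m - j)"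
      using card_Un_le[of "flips (f 0) (f i)" "flips (f i) (f m)"] 1(2) 2(2) by linarith
    finally show False using ij by linarith
  qed
  note less = this
  show ?thesis
  proof (rule inj_onI)
    fix i j assume ij: "i \<in> {..m}" "j \<in> {..m}" "f i = f j"
    show "i = j"
    proof (rule linorder_cases)
      assume "i < j"
      then show ?thesis using less[of i j] ij by simp
    next
      assume "j < i"
      then show ?thesis using less[of j i] ij by simp
    qed
  qed
qed

lemma waypoint_flip:
  assumes "finite (flips u v)" "i < card (flips u v)"
  shows "\<exists>j\<in>flips u v. flips (waypoint u v i) (waypoint u v (Suc i)) = {j}"
proof -
  define xs where "xs = sorted_list_of_set (flips u v)"
  have xs: "distinct xs" "set xs = flips u v" "i < length xs"
    using assms by (simp_all add: xs_def)
  have take: "take (Suc i) xs = take i xs @ [xs ! i]"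
    using xs(3) by (rule take_Suc_conv_app_nth)
  have "distinct (take (Suc i) xs)" using xs(1) by (rule distinct_take)
  then have notin: "xs ! i \<notin> set (take i xs)"
    unfolding take by simp
  have "set (take (Suc i) xs) = insert (xs ! i) (set (take i xs))"
    unfolding take by simp
  moreover have "snd (waypoint u v i) = sym_diff (snd u) (set (take i xs))" for i
    by (simp add: waypoint_def xs_def)
  ultimately have "flips (waypoint u v i) (waypoint u v (Suc i)) = {xs ! i}"
    unfolding flips_def[of "waypoint u v i"] using notin by auto
  then show ?thesis
    using xs(2,3) nth_mem by blast
qed

section \<open>The final graph on natural numbers\<close>

lemma walk_of_relpow:
  assumes "(x, y) \<in> adj E ^^ m" "x \<in> \<Union>E"
  shows "walk_of_length (g ` \<Union>E) ((`) g ` E) m (g x) (g y)"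
proof -
  obtain f where f: "f 0 = x" "f m = y" "\<And>i. i < m \<Longrightarrow> {f i, f (Suc i)} \<in> E"
    using assms(1) unfolding relpow_fun_conv adj_def by blast
  have V: "f i \<in> \<Union>E" if "i \<le> m" for i
  proof (cases i)
    case 0
    then show ?thesis using f(1) assms(2) by simp
  next
    case (Suc j)
    then show ?thesis using f(3)[of j] that by auto
  qed
  define ws where "ws = map (\<lambda>i. g (f i)) [0..<m + 1]"
  have len: "length ws = m + 1" and nth: "\<And>i. i \<le> m \<Longrightarrow> ws ! i = g (f i)"
    by (simp_all add: ws_def nth_append del: upt_Suc)
  have ne: "ws \<noteq> []" using len by auto
  have "set ws \<subseteq> g ` \<Union>E"
    using V by (auto simp: ws_def)
  moreover have "hd ws = g x"
    using hd_conv_nth[OF ne] nth[of 0] f(1) by simp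
  moreover have "last ws = g y"
    using last_conv_nth[OF ne] len nth[of m] f(2) by simp
  moreover have "{ws ! i, ws ! Suc i} \<in> (`) g ` E" if "i < m" for i
  proof -
    have "{ws ! i, ws ! Suc i} = g ` {f i, f (Suc i)}" using nth that by simp
    then show ?thesis using f(3)[OF that] by blast
  qed
  ultimately show ?thesis
    unfolding walk_of_length_def using len by blast
qed

text \<open>Links become paths and cells become single edges. A cell edge closes an ordinary
  geodesic to a cycle of length \<open>n + 1\<close>, the labels exclude shorter odd cycles, and the
  ends of all cells form the clique.\<close>

lemma stage_graph:
  assumes st: "stage n L C" and n: "even n" "2 \<le> n"
  shows "\<exists>(V :: nat set) E. simple_graph V E \<and> planar V E \<and> odd_girth V E = enat (n + 1) \<and>
     clique_number V (walk_power_edges V E (n - 1)) \<ge> 2 ^ n"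
proof -
  have fin: "finite L" "finite C" and drawn: "drawn (L \<union> C)"
    and links: "\<And>l. l \<in> L \<Longrightarrow> \<exists>u v. l = link u v \<and> flips u v \<subseteq> {..<n} \<and> flips u v \<noteq> {}"
    and inj_place: "\<And>c. c \<in> C \<Longrightarrow> inj (place c)"
    and label: "\<And>c. c \<in> C \<Longrightarrow> snd (dst c) = sym_diff (snd (src c)) {..<n}"
    and walk: "\<And>c. c \<in> C \<Longrightarrow> (src c, dst c) \<in> steps L ^^ n"
    and labels: "snd ` (\<Union>c\<in>C. ends c) = Pow {..<n}"
    and join: "\<And>c d. c \<in> C \<Longrightarrow> d \<in> C \<Longrightarrow> c \<noteq> d \<Longrightarrow>
        joined (steps L) (2 * n - 2) (src c) (dst c) (src d) (dst d) \<and>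
        joined (steps L) (2 * n - 2) (src c) (dst c) (dst d) (src d)"
    using st unfolding stage_def by simp_all
  have distinct: "fst (src a) \<noteq> fst (dst a)" if "a \<in> L \<union> C" for a
    using drawn that unfolding drawn_def by blast
  have link: "\<exists>u v. l = link u v \<and> flips u v \<subseteq> {..<n} \<and> finite (flips u v) \<and> flips u v \<noteq> {} \<and> fst u \<noteq> fst v"
    if l: "l \<in> L" for l
  proof -
    obtain u v where uv: "l = link u v" "flips u v \<subseteq> {..<n}" "flips u v \<noteq> {}"
      using links[OF l] by blast
    moreover have "fst u \<noteq> fst v" using distinct[of l] l uv(1) by (simp add: link_def)
    ultimately show ?thesis using finite_subset[OF uv(2)] by blast
  qed
  have disj: "l \<notin> C" if "l \<in> L" for l
    using link[OF that] inj_place not_inj_place_link by blast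
  \<comment> \<open>Of a cell only its edge is drawn; the triangle was space reserved for further
    refinement.\<close>
  define F where "F a = (if a \<in> C then {{src a, dst a}} else link_edges a)" for a
  define E where "E = (\<Union>a\<in>L \<union> C. F a)"
  define V where "V = \<Union>E"
  have F_link: "F l = link_edges l" if "l \<in> L" for l
    using disj[OF that] by (simp add: F_def)
  have F_cell: "F c = {{src c, dst c}}" if "c \<in> C" for c
    using that by (simp add: F_def)
  have cell_E: "{src c, dst c} \<in> E" if "c \<in> C" for c
    unfolding E_def using F_cell[OF that] that by blast
  have link_E: "link_edges l \<subseteq> E" if "l \<in> L" for l
    unfolding E_def using F_link[OF that] that by blast
  have ends: "ends c = {src c, dst c}" for c
    by (cases c) simp
  have ends_V: "ends c \<subseteq> V" if "c \<in> C" for c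
    unfolding V_def ends using cell_E[OF that] by blast

  have step_flips: "\<exists>j<n. flips p q = {j}" if pq: "(p, q) \<in> steps L" for p q
  proof -
    obtain l where l: "l \<in> L" "{p, q} \<in> link_edges l" using pq unfolding steps_def by blast
    obtain u v where uv: "l = link u v" "flips u v \<subseteq> {..<n}" "finite (flips u v)"
      using link[OF l(1)] by blast
    obtain i where i: "i < card (flips u v)" "{p, q} = {waypoint u v i, waypoint u v (Suc i)}"
      using l(2) unfolding uv(1) link_def link_edges.simps by blast
    obtain j where j: "j \<in> flips u v" "flips (waypoint u v i) (waypoint u v (Suc i)) = {j}"
      using waypoint_flip[OF uv(3) i(1)] by blast
    have "flips p q = flips (waypoint u v i) (waypoint u v (Suc i))"
      using i(2) unfolding doubleton_eq_iff flips_def by blast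
    then show ?thesis using j uv(2) by blast
  qed
  have edge_cases: "{p, q} \<in> E \<Longrightarrow> (p, q) \<in> steps L \<or> (\<exists>c\<in>C. {p, q} = {src c, dst c})" for p q
    unfolding E_def F_def steps_def by (auto split: if_splits)
  have edge_flips: "flips p q = {..<n} \<or> (\<exists>j<n. flips p q = {j})" if pq: "{p, q} \<in> E" for p q
    using edge_cases[OF pq]
  proof
    assume "\<exists>c\<in>C. {p, q} = {src c, dst c}"
    then obtain c where c: "c \<in> C" "{p, q} = {src c, dst c}" by blast
    have "flips (src c) (dst c) = {..<n}" unfolding flips_def label[OF c(1)] by blast
    moreover have "flips p q = flips (src c) (dst c)"
      using c(2) unfolding doubleton_eq_iff flips_def by blast
    ultimately show ?thesis by simp
  qed (use step_flips in blast)
  have E_pair: "\<exists>p q. e = {p, q}" if e: "e \<in> E" for e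
  proof -
    obtain a where a: "a \<in> L \<union> C" "e \<in> F a" using e unfolding E_def by blast
    show ?thesis
    proof (cases "a \<in> C")
      case True
      then show ?thesis using a F_cell by blast
    next
      case False
      then have "a \<in> L" using a by blast
      then obtain u v where uv: "a = link u v" using link by blast
      have "e \<in> link_edges a" using a(2) F_link[OF \<open>a \<in> L\<close>] by simp
      then show ?thesis unfolding uv link_def link_edges.simps by blast
    qed
  qed
  have sep: "separated E"
    unfolding E_def
  proof (rule separated_pieces[OF drawn])
    fix a e assume a: "a \<in> L \<union> C" "e \<in> F a"
    show "convex hull (fst ` e) \<subseteq> region a"
    proof (cases "a \<in> C")
      case True
      then have e: "e = {src a, dst a}" using a F_cell by blast
      show ?thesis unfolding e by (cases a) (auto intro!: hull_mono simp: image_insert)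
    next
      case False
      then have "a \<in> L" using a by blast
      then show ?thesis using link[of a] link_edges_drawn(1) a(2) F_link[of a] by metis
    qed
    show "w \<in> e" if w: "w \<in> ends a" "fst w \<in> convex hull (fst ` e)" for w
    proof (cases "a \<in> C")
      case True
      then have e: "e = {src a, dst a}" using a F_cell by blast
      show ?thesis using w(1) unfolding e ends .
    next
      case False
      then have "a \<in> L" using a by blast
      then show ?thesis using link[of a] link_edges_drawn(2) a(2) F_link[of a] w by metis
    qed
  next
    fix a assume a: "a \<in> L \<union> C"
    show "separated (F a)"
    proof (cases "a \<in> C")
      case True
      show ?thesis unfolding F_cell[OF True] separated_def by blast
    next
      case False
      then have "a \<in> L" using a by blast
      then show ?thesis using link[of a] link_edges_drawn(3) F_link[of a] by metis
    qed
  qed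
  have E_straight: "fst p \<noteq> fst q" if pq: "{p, q} \<in> E" for p q
  proof (cases "\<exists>c\<in>C. {p, q} = {src c, dst c}")
    case True
    then obtain c where "c \<in> C" "{p, q} = {src c, dst c}" by blast
    then show ?thesis using distinct[of c] unfolding doubleton_eq_iff by auto
  next
    case False
    then have "(p, q) \<in> steps L" using edge_cases[OF pq] by blast
    then obtain l where l: "l \<in> L" "{p, q} \<in> link_edges l" unfolding steps_def by blast
    obtain u v where uv: "l = link u v" "fst u \<noteq> fst v"
      using link[OF l(1)] by blast
    obtain i where i: "i < card (flips u v)" "{p, q} = {waypoint u v i, waypoint u v (Suc i)}"
      using l(2) unfolding uv(1) link_def link_edges.simps by blast
    have "fst (waypoint u v i) \<noteq> fst (waypoint u v (Suc i))"
      unfolding waypoint_def fst_conv linepath_eq_iff[OF uv(2)] using i(1) by simp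
    then show ?thesis using i(2) unfolding doubleton_eq_iff by auto
  qed
  have finE: "finite E"
  proof -
    have "finite (link_edges l)" if "l \<in> L" for l
      by (cases l) simp
    then show ?thesis
      unfolding E_def using fin by (auto simp: F_def)
  qed
  have finV: "finite V"
    unfolding V_def using finE E_pair by (intro finite_Union) auto

  \<comment> \<open>Vertices are renamed by natural numbers; \<open>h\<close> undoes this on
    \<open>V\<close>, so positions and labels are read through \<open>h\<close>.\<close>
  obtain g :: "vertex \<Rightarrow> nat" where g: "inj_on g V"
    using finV finite_imp_inj_to_nat_seg by metis
  define h where "h = inv_into V g"
  have hg: "h (g v) = v" if "v \<in> V" for v
    unfolding h_def using inv_into_f_f[OF g that] .
  define E' where "E' = (`) g ` E"
  have V': "g ` V = \<Union>E'"
    unfolding E'_def V_def by blast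
  have EV: "e \<subseteq> V" if "e \<in> E" for e
    unfolding V_def using that by blast
  have h_image: "h ` g ` e = e" if "e \<subseteq> V" for e
    using hg that by (force simp: image_iff)
  have lab: "sym_diff ((snd \<circ> h) a) ((snd \<circ> h) b) = {..<n} \<or> (\<exists>j<n. sym_diff ((snd \<circ> h) a) ((snd \<circ> h) b) = {j})"
    if ab: "{a, b} \<in> E'" for a b
  proof -
    obtain e where e: "e \<in> E" "{a, b} = g ` e" using ab unfolding E'_def by blast
    have "h ` {a, b} = e" unfolding e(2) by (rule h_image[OF EV[OF e(1)]])
    then have "{h a, h b} \<in> E" using e(1) by simp
    from edge_flips[OF this] show ?thesis unfolding flips_def comp_def .
  qed

  have simple: "simple_graph (g ` V) E'"
    unfolding simple_graph_def
  proof (intro conjI ballI)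
    fix e' assume "e' \<in> E'"
    then obtain e where e: "e \<in> E" "e' = g ` e" unfolding E'_def by blast
    obtain p q where pq: "e = {p, q}" using E_pair[OF e(1)] by blast
    have V: "p \<in> V" "q \<in> V" using EV[OF e(1)] pq by auto
    have "p \<noteq> q" using E_straight e(1) pq by blast
    then have "g p \<noteq> g q" using g V by (meson inj_onD)
    then show "\<exists>x y. x \<in> g ` V \<and> y \<in> g ` V \<and> x \<noteq> y \<and> e' = {x, y}"
      using V e(2) pq by (intro exI[of _ "g p"] exI[of _ "g q"]) simp
  qed (use finV in simp)

  have planar: "planar (g ` V) E'"
  proof (rule planar_straight[where pos = "fst \<circ> h"])
    fix e' assume "e' \<in> E'"
    then obtain e where e: "e \<in> E" "e' = g ` e" unfolding E'_def by blast
    obtain p q where pq: "e = {p, q}" using E_pair[OF e(1)] by blast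
    have V: "p \<in> V" "q \<in> V" using EV[OF e(1)] pq by auto
    have "fst p \<noteq> fst q" using E_straight e(1) pq by blast
    then show "\<exists>u v. e' = {u, v} \<and> (fst \<circ> h) u \<noteq> (fst \<circ> h) v"
      using e(2) pq hg[OF V(1)] hg[OF V(2)] by (intro exI[of _ "g p"] exI[of _ "g q"]) simp
  next
    show "g ` V = \<Union>E'" by (rule V')
  next
    fix e' f' assume ef': "e' \<in> E'" "f' \<in> E'" "e' \<noteq> f'"
    obtain e where e: "e \<in> E" "e' = g ` e" using ef'(1) unfolding E'_def by blast
    obtain f where f: "f \<in> E" "f' = g ` f" using ef'(2) unfolding E'_def by blast
    have pos: "(fst \<circ> h) ` g ` d = fst ` d" if "d \<subseteq> V" for d
      unfolding image_comp[symmetric] h_image[OF that] ..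
    have int: "e' \<inter> f' = g ` (e \<inter> f)"
      unfolding e(2) f(2) using inj_on_image_Int[OF g EV[OF e(1)] EV[OF f(1)]] by simp
    have "e \<noteq> f" using ef'(3) e(2) f(2) by blast
    then have "convex hull (fst ` e) \<inter> convex hull (fst ` f) \<subseteq> fst ` (e \<inter> f)"
      using sep e(1) f(1) unfolding separated_def by blast
    moreover have "e \<inter> f \<subseteq> V" using EV[OF e(1)] by blast
    ultimately show "convex hull ((fst \<circ> h) ` e') \<inter> convex hull ((fst \<circ> h) ` f') \<subseteq> (fst \<circ> h) ` (e' \<inter> f')"
      unfolding int unfolding e(2) f(2) by (simp only: pos EV[OF e(1)] EV[OF f(1)])
  qed

  have steps_adj: "steps L \<subseteq> adj E"
    unfolding steps_eq_adj adj_def using link_E by blast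

  have cycle: "has_cycle_of_length (g ` V) E' (n + 1)"
  proof -
    have "C \<noteq> {}" using labels by auto
    then obtain c where c: "c \<in> C" by blast
    obtain f where f: "f 0 = src c" "f n = dst c" "\<And>i. i < n \<Longrightarrow> (f i, f (Suc i)) \<in> steps L"
      using walk[OF c] unfolding relpow_fun_conv by blast
    have "flips (src c) (dst c) = {..<n}" unfolding flips_def label[OF c] by blast
    then have "card (flips (f 0) (f n)) = n" unfolding f(1,2) by simp
    \<comment> \<open>The ends of a cell differ in all \<open>n\<close> elements, so a walk of
      length \<open>n\<close> between them repeats no vertex.\<close>
    from geodesic_distinct[OF step_flips f(3) this] have inj: "inj_on f {..n}" .
    have fE: "{f i, f (Suc i)} \<in> E" if "i < n" for i
      using f(3)[OF that] steps_adj unfolding adj_def by blast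
    have fV: "f i \<in> V" if "i \<le> n" for i
    proof (cases "i < n")
      case True
      then show ?thesis using EV[OF fE] by blast
    next
      case False
      then have "i = n" using that by simp
      then show ?thesis using f(2) ends_V[OF c] ends by blast
    qed
    define cs where "cs = map (\<lambda>i. g (f i)) [0..<n + 1]"
    have len: "length cs = n + 1" and nth: "\<And>i. i \<le> n \<Longrightarrow> cs ! i = g (f i)"
      by (simp_all add: cs_def nth_append del: upt_Suc)
    have "inj_on (\<lambda>i. g (f i)) {..n}"
      using comp_inj_on[OF inj inj_on_subset[OF g]] fV by (force simp: comp_def)
    moreover have "set [0..<n + 1] = {..n}" by auto
    ultimately have "distinct cs"
      unfolding cs_def distinct_map by (simp del: upt_Suc)
    moreover have "set cs \<subseteq> g ` V" using fV by (auto simp: cs_def)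
    moreover have "{cs ! i, cs ! ((i + 1) mod (n + 1))} \<in> E'" if i: "i < n + 1" for i
    proof (cases "i < n")
      case True
      then have "{cs ! i, cs ! ((i + 1) mod (n + 1))} = g ` {f i, f (Suc i)}"
        using nth by simp
      then show ?thesis unfolding E'_def using fE[OF True] by blast
    next
      case False
      \<comment> \<open>Here the index wraps round to \<open>0\<close>, and the closing edge is the
        cell edge.\<close>
      then have "i = n" using i by simp
      then have "{cs ! i, cs ! ((i + 1) mod (n + 1))} = g ` {src c, dst c}"
        using nth f(1,2) by (simp add: insert_commute)
      then show ?thesis unfolding E'_def using cell_E[OF c] by blast
    qed
    ultimately show ?thesis
      unfolding has_cycle_of_length_def using len n(2) by (intro conjI exI[of _ cs]) simp_all
  qed
  have girth: "odd_girth (g ` V) E' = enat (n + 1)"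
    unfolding odd_girth_def
  proof (rule antisym)
    show "(INF l\<in>{l. odd l \<and> has_cycle_of_length (g ` V) E' l}. enat l) \<le> enat (n + 1)"
      by (rule INF_lower) (use cycle n(1) in simp)
    show "enat (n + 1) \<le> (INF l\<in>{l. odd l \<and> has_cycle_of_length (g ` V) E' l}. enat l)"
    proof (rule INF_greatest)
      fix l assume "l \<in> {l. odd l \<and> has_cycle_of_length (g ` V) E' l}"
      then have "n + 1 \<le> l"
        using odd_cycle_length[of E' "snd \<circ> h" n "g ` V" l, OF lab n(1)] by blast
      then show "enat (n + 1) \<le> enat l" by simp
    qed
  qed

  define par where "par p \<longleftrightarrow> even (card (snd p \<inter> {..<n}))" for p :: vertex
  have par_walk: "even m \<longleftrightarrow> (par p \<longleftrightarrow> par q)" if "(p, q) \<in> steps L ^^ m" for p q m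
    unfolding par_def using relpow_flips(3)[OF step_flips that] .
  have par_cell: "par (src c) \<longleftrightarrow> par (dst c)" if "c \<in> C" for c
    using par_walk[OF walk[OF that]] n(1) by simp
  have src_dst: "(src c, dst c) \<in> adj E" "(dst c, src c) \<in> adj E" if "c \<in> C" for c
    using cell_E[OF that] unfolding adj_def by (simp_all add: insert_commute)
  have odd_walk: "(p, q) \<in> adj E ^^ (n - 1)"
    if p: "c \<in> C" "p \<in> ends c" and q: "d \<in> C" "q \<in> ends d" and "p \<noteq> q" for c d p q
  proof (cases "c = d")
    case True
    \<comment> \<open>Two ends of one cell are joined by the cell edge, an odd walk that only needs
      padding.\<close>
    then have "(p, q) \<in> adj E"
      using p q \<open>p \<noteq> q\<close> src_dst unfolding ends by blast
    then have "(p, q) \<in> adj E ^^ 1" by simp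
    then show ?thesis by (rule pad_walk[OF sym_adj]) (use n in simp_all)
  next
    case False
    have J: "joined (steps L) (2 * n - 2) (src c) (dst c) (src d) (dst d)"
      "joined (steps L) (2 * n - 2) (src c) (dst c) (dst d) (src d)"
      using join[OF p(1) q(1) False] by blast+
    \<comment> \<open>The four choices of ends are instances of this fact. Exchanging the ends of
      just one cell swaps the straight and the crossed bound; starting at \<open>dst c\<close> calls
      for \<open>joined_swap\<close>.\<close>
    note W = short_odd_walk[OF sym_adj steps_adj _ _ n par_walk]
    have "(src c, src d) \<in> adj E ^^ (n - 1)"
      by (rule W[OF src_dst(1)[OF p(1)] src_dst(1)[OF q(1)] _ par_cell[OF p(1)] par_cell[OF q(1)] J])
    moreover have "(src c, dst d) \<in> adj E ^^ (n - 1)"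
      by (rule W[OF src_dst(1)[OF p(1)] src_dst(2)[OF q(1)] _ par_cell[OF p(1)] par_cell[OF q(1), symmetric] J(2,1)])
    moreover have "(dst c, src d) \<in> adj E ^^ (n - 1)"
      by (rule W[OF src_dst(2)[OF p(1)] src_dst(1)[OF q(1)] _ par_cell[OF p(1), symmetric] par_cell[OF q(1)] J(2,1)[THEN joined_swap]])
    moreover have "(dst c, dst d) \<in> adj E ^^ (n - 1)"
      by (rule W[OF src_dst(2)[OF p(1)] src_dst(2)[OF q(1)] _ par_cell[OF p(1), symmetric] par_cell[OF q(1), symmetric] J[THEN joined_swap]])
    ultimately show ?thesis using p(2) q(2) unfolding ends by blast
  qed

  define K where "K = (\<Union>c\<in>C. ends c)"
  have KV: "K \<subseteq> V" unfolding K_def using ends_V by blast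
  have "is_clique (g ` V) (walk_power_edges (g ` V) E' (n - 1)) (g ` K)"
    unfolding is_clique_def
  proof (intro conjI ballI impI)
    show "g ` K \<subseteq> g ` V" using KV by blast
    fix x y assume xy: "x \<in> g ` K" "y \<in> g ` K" "x \<noteq> y"
    obtain p where p: "p \<in> K" "x = g p" using xy by blast
    obtain q where q: "q \<in> K" "y = g q" using xy by blast
    obtain c where c: "c \<in> C" "p \<in> ends c" using p unfolding K_def by blast
    obtain d where d: "d \<in> C" "q \<in> ends d" using q unfolding K_def by blast
    have "p \<noteq> q" using xy(3) p q by blast
    have "p \<in> \<Union>E" using p(1) KV unfolding V_def by blast
    from walk_of_relpow[OF odd_walk[OF c d \<open>p \<noteq> q\<close>] this, of g]
    have "walk_of_length (g ` V) E' (n - 1) x y"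
      unfolding p(2) q(2) E'_def V_def .
    moreover have "x \<in> g ` V" "y \<in> g ` V" using p q KV by blast+
    ultimately show "{x, y} \<in> walk_power_edges (g ` V) E' (n - 1)"
      unfolding walk_power_edges_def using xy(3) by blast
  qed
  moreover have "finite {card K' |K'. is_clique (g ` V) (walk_power_edges (g ` V) E' (n - 1)) K'}"
  proof -
    have "{card K' |K'. is_clique (g ` V) (walk_power_edges (g ` V) E' (n - 1)) K'} \<subseteq> card ` Pow (g ` V)"
      unfolding is_clique_def by blast
    then show ?thesis by (rule finite_subset) (use finV in simp)
  qed
  ultimately have "card (g ` K) \<le> clique_number (g ` V) (walk_power_edges (g ` V) E' (n - 1))"
    unfolding clique_number_def by (intro Max_ge) blast+
  moreover have "2 ^ n \<le> card (g ` K)"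
  proof -
    \<comment> \<open>Every subset of \<open>{..<n}\<close> is a label on \<open>K\<close>, so
      counting labels bounds the size of \<open>K\<close> from below.\<close>
    have "2 ^ n = card (snd ` K)" unfolding K_def labels by (simp add: card_Pow)
    also have "\<dots> \<le> card K" using finite_subset[OF KV finV] by (rule card_image_le)
    also have "\<dots> = card (g ` K)" using card_image[OF inj_on_subset[OF g KV]] by simp
    finally show ?thesis .
  qed
  ultimately have "2 ^ n \<le> clique_number (g ` V) (walk_power_edges (g ` V) E' (n - 1))"
    by linarith
  then show ?thesis using simple planar girth by blast
qed

theorem theorem4:
  fixes k :: nat
  assumes "1 \<le> k"
  shows "\<exists>(V :: nat set) (E :: nat set set).
           simple_graph V E \<and> planar V E \<and>
           odd_girth V E = enat (2 * k + 1) \<and>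
           clique_number V (walk_power_edges V E (2 * k - 1)) \<ge> 2 ^ (2 * k)"
proof -
  obtain L C where st: "stage (2 * k) L C"
    using stage_exists[OF assms] by blast
  show ?thesis
    by (rule stage_graph[OF st]) (use assms in simp_all)
qed

end
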